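(* Let $R$ be a commutative unital ring in which $x^2=0$ implies $x=0$, and let $A := R[t_1,\ldots,t_d]$ be the polynomial algebra with $d\geq 2$. Then there is no non-trivial double Poisson structure on $A$; that is, the only double Poisson structure $A\otimes A\to A\otimes A$ is the zero map.
   Context: All tensor products are over the commutative unital ring $R$; $A$ is a unital associative $R$-algebra, and $A^{\otimes n}$ has the usual tensor product algebra structure. The symmetric group $\mathfrak{S}_n$ acts on $A^{\otimes n}$ by $\sigma(a_1\otimes\cdots\otimes a_n)=a_{\sigma^{-1}(1)}\otimes\cdots\otimes a_{\sigma^{-1}(n)}$ and on $\mathrm{Hom}_R(A^{\otimes n},A^{\otimes n})$ by $\sigma\cdot\phi=\sigma\circ\phi\circ\sigma^{-1}$. The cyclic group $\mathbb{Z}/n$ is regarded as the subgroup of $\mathfrak{S}_n$ generated by the cycle $(1\,2\,\cdots\,n)$. A map $\phi\in\mathrm{Hom}_R(A^{\otimes 2},A^{\otimes 2})$ is a derivation with respect to the last variable if $\phi(c\otimes ab)=(a\otimes 1)\phi(c\otimes b)+\phi(c\otimes a)(1\otimes b)$ for all $a,b,c\in A$. A double bracket on $A$ is an $R$-linear map $\phi:A^{\otimes 2}\to A^{\otimes 2}$ which is a derivation with respect to the last variable and satisfies $\tau\circ\phi\circ\tau=-\phi$, where $\tau$ is the transposition of the tensor factors (so $\tau\cdot\phi=-\phi$ is then also a derivation with respect to the last variable). The double Jacobiator of $\phi$ is $\mathfrak{Jac}(\phi):=\sum_{\sigma\in\mathbb{Z}/3}\sigma\cdot\big((\phi\otimes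 1_A)\circ(1_A\otimes\phi)\big)\in\mathrm{Hom}_R(A^{\otimes 3},A^{\otimes 3})$. A double Poisson structure on $A$ is a double bracket $\phi$ with $\mathfrak{Jac}(\phi)=0$. *)

theory Defs
  imports
    "HOL-Library.Poly_Mapping"
    "HOL-Library.Cardinality"
    "HOL-Combinatorics.Combinatorics"
begin

section \<open>Free modules\<close>

text \<open>
  The type \<open>'x \<Rightarrow>\<^sub>0 'r\<close> serves both as the free \<open>'r\<close>-module with basis \<open>'x\<close> and, for a monoid
  of exponents \<open>'x\<close>, as a polynomial ring; in both roles \<open>pm_scale\<close> is the scalar multiplication.
\<close>

definition pm_scale :: "'r::comm_ring_1 \<Rightarrow> ('x \<Rightarrow>\<^sub>0 'r) \<Rightarrow> ('x \<Rightarrow>\<^sub>0 'r)" where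
  "pm_scale r f = Poly_Mapping.map ((*) r) f"

lemma lookup_pm_scale [simp]: "Poly_Mapping.lookup (pm_scale r f) x = r * Poly_Mapping.lookup f x"
  by (simp add: pm_scale_def Poly_Mapping.map.rep_eq when_def)

interpretation pm: module "pm_scale :: 'r::comm_ring_1 \<Rightarrow> ('x \<Rightarrow>\<^sub>0 'r) \<Rightarrow> ('x \<Rightarrow>\<^sub>0 'r)"
  by standard (rule poly_mapping_eqI; simp add: lookup_add algebra_simps)+

definition pm_extend :: "('x \<Rightarrow> 'y \<Rightarrow>\<^sub>0 'r) \<Rightarrow> ('x \<Rightarrow>\<^sub>0 'r) \<Rightarrow> ('y \<Rightarrow>\<^sub>0 'r::comm_ring_1)" where
  "pm_extend g f = (\<Sum>x\<in>Poly_Mapping.keys f. pm_scale (Poly_Mapping.lookup f x) (g x))"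

lemma pm_extend_superset:
  assumes "finite S" "Poly_Mapping.keys f \<subseteq> S"
  shows "pm_extend g f = (\<Sum>x\<in>S. pm_scale (Poly_Mapping.lookup f x) (g x))"
  unfolding pm_extend_def
  by (rule sum.mono_neutral_left) (use assms in \<open>auto simp: in_keys_iff\<close>)

lemma pm_extend_single [simp]: "pm_extend g (Poly_Mapping.single x r) = pm_scale r (g x)"
  by (simp add: pm_extend_def)

lemma pm_extend_add: "pm_extend g (f + f') = pm_extend g f + pm_extend g f'"
proof -
  let ?S = "Poly_Mapping.keys f \<union> Poly_Mapping.keys f'"
  have "Poly_Mapping.keys (f + f') \<subseteq> ?S" by (rule keys_add)
  then show ?thesis
    by (simp add: pm_extend_superset[of ?S] lookup_add pm.scale_left_distrib sum.distrib)
qed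

lemma pm_extend_scale: "pm_extend g (pm_scale r f) = pm_scale r (pm_extend g f)"
proof -
  have "Poly_Mapping.keys (pm_scale r f) \<subseteq> Poly_Mapping.keys f" by (auto simp: in_keys_iff)
  then show ?thesis
    by (simp add: pm_extend_superset[of "Poly_Mapping.keys f"] pm.scale_sum_right)
qed

lemma module_hom_pm_extend: "module_hom pm_scale pm_scale (pm_extend g)"
  by standard (simp_all add: pm_extend_add pm_extend_scale)

section \<open>Tensor powers of an associative algebra\<close>

type_synonym ('a, 'r) tens = "('a list \<Rightarrow>\<^sub>0 'r) set"

locale assoc_algebra = module scale
  for scale :: "'r::comm_ring_1 \<Rightarrow> 'a::ring_1 \<Rightarrow> 'a" +
  assumes scale_mult_left: "scale r a * b = scale r (a * b)"
    and scale_mult_right: "a * scale r b = scale r (a * b)"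
begin

text \<open>
  The \<open>n\<close>-th tensor power of the algebra is the free module on the lists of length \<open>n\<close>
  modulo the submodule \<open>tnull n\<close> generated by the multilinearity relations;
  its elements are the cosets \<open>tclass n f\<close>.
\<close>

definition tfree :: "nat \<Rightarrow> ('a list \<Rightarrow>\<^sub>0 'r) set" where
  "tfree n = {f. \<forall>xs\<in>Poly_Mapping.keys f. length xs = n}"

definition trel :: "nat \<Rightarrow> ('a list \<Rightarrow>\<^sub>0 'r) set" where
  "trel n =
    {Poly_Mapping.single (xs[i := a + b]) 1
       - Poly_Mapping.single (xs[i := a]) 1 - Poly_Mapping.single (xs[i := b]) 1
     | xs i a b. length xs = n \<and> i < n} \<union>
    {Poly_Mapping.single (xs[i := scale r a]) 1 - Poly_Mapping.single (xs[i := a]) r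
     | xs i r a. length xs = n \<and> i < n}"

definition tnull :: "nat \<Rightarrow> ('a list \<Rightarrow>\<^sub>0 'r) set" where
  "tnull n = pm.span (trel n)"

definition tclass :: "nat \<Rightarrow> ('a list \<Rightarrow>\<^sub>0 'r) \<Rightarrow> ('a list \<Rightarrow>\<^sub>0 'r) set" where
  "tclass n f = {g. g - f \<in> tnull n}"

definition tpow :: "nat \<Rightarrow> ('a, 'r) tens set" where
  "tpow n = tclass n ` tfree n"

definition trep :: "('a, 'r) tens \<Rightarrow> ('a list \<Rightarrow>\<^sub>0 'r)" where
  "trep S = (SOME f. f \<in> S)"

definition tpure :: "'a list \<Rightarrow> ('a, 'r) tens" where
  "tpure xs = tclass (length xs) (Poly_Mapping.single xs 1)"

text \<open>
  The operations below are computed on arbitrarily chosen representatives; the lemmas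
  \<open>tadd_class\<close> to \<open>tmap_class\<close> show that they do not depend on the choice.
\<close>

definition tzero :: "nat \<Rightarrow> ('a, 'r) tens" where
  "tzero n = tclass n 0"

definition tadd :: "nat \<Rightarrow> ('a, 'r) tens \<Rightarrow> ('a, 'r) tens \<Rightarrow> ('a, 'r) tens" where
  "tadd n S T = tclass n (trep S + trep T)"

definition tneg :: "nat \<Rightarrow> ('a, 'r) tens \<Rightarrow> ('a, 'r) tens" where
  "tneg n S = tclass n (- trep S)"

definition tscale :: "nat \<Rightarrow> 'r \<Rightarrow> ('a, 'r) tens \<Rightarrow> ('a, 'r) tens" where
  "tscale n r S = tclass n (pm_scale r (trep S))"

definition tsum :: "nat \<Rightarrow> ('i \<Rightarrow> ('a, 'r) tens) \<Rightarrow> 'i set \<Rightarrow> ('a, 'r) tens" where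
  "tsum n F I = tclass n (\<Sum>i\<in>I. trep (F i))"

definition fmult :: "('a list \<Rightarrow>\<^sub>0 'r) \<Rightarrow> ('a list \<Rightarrow>\<^sub>0 'r) \<Rightarrow> ('a list \<Rightarrow>\<^sub>0 'r)" where
  "fmult f g =
    pm_extend (\<lambda>xs. pm_extend (\<lambda>ys. Poly_Mapping.single (map2 (*) xs ys) 1) g) f"

definition tmult :: "nat \<Rightarrow> ('a, 'r) tens \<Rightarrow> ('a, 'r) tens \<Rightarrow> ('a, 'r) tens" where
  "tmult n S T = tclass n (fmult (trep S) (trep T))"

definition fappend :: "('a list \<Rightarrow>\<^sub>0 'r) \<Rightarrow> ('a list \<Rightarrow>\<^sub>0 'r) \<Rightarrow> ('a list \<Rightarrow>\<^sub>0 'r)" where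
  "fappend f g =
    pm_extend (\<lambda>xs. pm_extend (\<lambda>ys. Poly_Mapping.single (xs @ ys) 1) g) f"

definition tappend ::
  "nat \<Rightarrow> nat \<Rightarrow> ('a, 'r) tens \<Rightarrow> ('a, 'r) tens \<Rightarrow> ('a, 'r) tens" where
  "tappend m n S T = tclass (m + n) (fappend (trep S) (trep T))"

text \<open>
  Tensor positions are numbered from \<open>0\<close>. As \<open>permute_list p xs ! i = xs ! p i\<close>, the action
  \<open>\<sigma>(a\<^sub>1 \<otimes> \<dots> \<otimes> a\<^sub>n) = a\<^bsub>\<sigma>\<^sup>-\<^sup>1(1)\<^esub> \<otimes> \<dots> \<otimes> a\<^bsub>\<sigma>\<^sup>-\<^sup>1(n)\<^esub>\<close> involves the inverse.
\<close>

definition tperm :: "nat \<Rightarrow> (nat \<Rightarrow> nat) \<Rightarrow> ('a, 'r) tens \<Rightarrow> ('a, 'r) tens" where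
  "tperm n \<sigma> S =
    tclass n (pm_extend (\<lambda>xs. Poly_Mapping.single (permute_list (inv \<sigma>) xs) 1) (trep S))"

text \<open>
  A map between tensor powers is a function on cosets that is only relevant on \<open>tpow n\<close>.
\<close>

definition tlinear ::
  "nat \<Rightarrow> nat \<Rightarrow> (('a, 'r) tens \<Rightarrow> ('a, 'r) tens) \<Rightarrow> bool" where
  "tlinear n m \<phi> \<longleftrightarrow>
    (\<forall>S\<in>tpow n. \<phi> S \<in> tpow m) \<and>
    (\<forall>S\<in>tpow n. \<forall>T\<in>tpow n. \<phi> (tadd n S T) = tadd m (\<phi> S) (\<phi> T)) \<and>
    (\<forall>r. \<forall>S\<in>tpow n. \<phi> (tscale n r S) = tscale m r (\<phi> S))"

text \<open>
  The tensor product of \<open>\<phi>\<close>, from the \<open>m\<close>-th to the \<open>m'\<close>-th tensor power, and \<open>\<psi>\<close>, from the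
  \<open>n\<close>-th to the \<open>n'\<close>-th tensor power.
\<close>

definition tmap :: "nat \<Rightarrow> nat \<Rightarrow> nat \<Rightarrow> nat \<Rightarrow>
    (('a, 'r) tens \<Rightarrow> ('a, 'r) tens) \<Rightarrow> (('a, 'r) tens \<Rightarrow> ('a, 'r) tens) \<Rightarrow>
    ('a, 'r) tens \<Rightarrow> ('a, 'r) tens" where
  "tmap m m' n n' \<phi> \<psi> S =
    tclass (m' + n')
      (pm_extend (\<lambda>xs. trep (tappend m' n' (\<phi> (tpure (take m xs))) (\<psi> (tpure (drop m xs)))))
        (trep S))"

section \<open>Double Poisson structures\<close>

definition sym_act :: "nat \<Rightarrow> (nat \<Rightarrow> nat) \<Rightarrow>
    (('a, 'r) tens \<Rightarrow> ('a, 'r) tens) \<Rightarrow> ('a, 'r) tens \<Rightarrow> ('a, 'r) tens" where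
  "sym_act n \<sigma> \<phi> = tperm n \<sigma> \<circ> \<phi> \<circ> tperm n (inv \<sigma>)"

definition cyclic_perms :: "nat \<Rightarrow> (nat \<Rightarrow> nat) set" where
  "cyclic_perms n = range (\<lambda>k. cycle_of_list [0..<n] ^^ k)"

definition derivation_last :: "(('a, 'r) tens \<Rightarrow> ('a, 'r) tens) \<Rightarrow> bool" where
  "derivation_last \<phi> \<longleftrightarrow>
    (\<forall>a b c. \<phi> (tpure [c, a * b]) =
      tadd 2 (tmult 2 (tpure [a, 1]) (\<phi> (tpure [c, b])))
             (tmult 2 (\<phi> (tpure [c, a])) (tpure [1, b])))"

definition double_bracket :: "(('a, 'r) tens \<Rightarrow> ('a, 'r) tens) \<Rightarrow> bool" where
  "double_bracket \<phi> \<longleftrightarrow>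
    tlinear 2 2 \<phi> \<and> derivation_last \<phi> \<and>
    (let \<tau> = tperm 2 (transpose 0 1) in \<forall>S\<in>tpow 2. (\<tau> \<circ> \<phi> \<circ> \<tau>) S = tneg 2 (\<phi> S))"

definition double_jacobiator ::
  "(('a, 'r) tens \<Rightarrow> ('a, 'r) tens) \<Rightarrow> ('a, 'r) tens \<Rightarrow> ('a, 'r) tens" where
  "double_jacobiator \<phi> S =
    tsum 3 (\<lambda>\<sigma>. sym_act 3 \<sigma> (tmap 2 2 1 1 \<phi> id \<circ> tmap 1 1 2 2 id \<phi>) S) (cyclic_perms 3)"

definition double_poisson :: "(('a, 'r) tens \<Rightarrow> ('a, 'r) tens) \<Rightarrow> bool" where
  "double_poisson \<phi> \<longleftrightarrow>
    double_bracket \<phi> \<and> (\<forall>S\<in>tpow 3. double_jacobiator \<phi> S = tzero 3)"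

section \<open>Independence of representatives\<close>

lemma subspace_tnull: "pm.subspace (tnull n)"
  by (simp add: tnull_def)

lemma tclass_eq_iff: "tclass n f = tclass n g \<longleftrightarrow> f - g \<in> tnull n"
proof
  assume "tclass n f = tclass n g"
  moreover have "f \<in> tclass n f"
    by (simp add: tclass_def tnull_def pm.span_zero)
  ultimately show "f - g \<in> tnull n" by (auto simp: tclass_def)
next
  assume *: "f - g \<in> tnull n"
  have "h - f \<in> tnull n \<longleftrightarrow> h - g \<in> tnull n" for h
    using pm.subspace_add[OF subspace_tnull _ *, of "h - f"]
      pm.subspace_diff[OF subspace_tnull _ *, of "h - g"] by auto
  then show "tclass n f = tclass n g" by (auto simp: tclass_def)
qed

lemma trep_tclass: "trep (tclass n f) - f \<in> tnull n"
proof -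
  have "f \<in> tclass n f" by (simp add: tclass_def tnull_def pm.span_zero)
  then have "trep (tclass n f) \<in> tclass n f" unfolding trep_def by (rule someI)
  then show ?thesis by (simp add: tclass_def)
qed

lemma tclass_trep: "S \<in> tpow n \<Longrightarrow> tclass n (trep S) = S"
  unfolding tpow_def by (elim imageE) (simp add: tclass_eq_iff trep_tclass)

lemma tfree_single [simp]: "length xs = n \<Longrightarrow> Poly_Mapping.single xs r \<in> tfree n"
  by (simp add: tfree_def)

lemma subspace_tfree: "pm.subspace (tfree n)"
proof (rule pm.subspaceI)
  show "0 \<in> tfree n" by (simp add: tfree_def)
  show "f + g \<in> tfree n" if "f \<in> tfree n" "g \<in> tfree n" for f g
    using that keys_add[of f g] by (fastforce simp: tfree_def)
  show "pm_scale r f \<in> tfree n" if "f \<in> tfree n" for r f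
    using that by (auto simp: tfree_def in_keys_iff)
qed

lemma tnull_subset_tfree: "tnull n \<subseteq> tfree n"
  unfolding tnull_def
  by (rule pm.span_minimal)
    (auto simp: trel_def intro!: pm.subspace_diff[OF subspace_tfree] subspace_tfree)

lemma trep_in_tfree: "S \<in> tpow n \<Longrightarrow> trep S \<in> tfree n"
proof -
  assume "S \<in> tpow n"
  then obtain f where f: "S = tclass n f" "f \<in> tfree n" by (auto simp: tpow_def)
  have "trep S - f \<in> tfree n" using trep_tclass tnull_subset_tfree f by auto
  then show ?thesis using pm.subspace_add[OF subspace_tfree _ f(2), of "trep S - f"] by simp
qed

lemma tadd_class: "tadd n (tclass n f) (tclass n g) = tclass n (f + g)"
  using pm.subspace_add[OF subspace_tnull trep_tclass trep_tclass, of n f g]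
  by (simp add: tadd_def tclass_eq_iff algebra_simps)

lemma tneg_class: "tneg n (tclass n f) = tclass n (- f)"
  using pm.subspace_neg[OF subspace_tnull trep_tclass, of n f]
  by (simp add: tneg_def tclass_eq_iff algebra_simps)

lemma tscale_class: "tscale n r (tclass n f) = tclass n (pm_scale r f)"
  using pm.subspace_scale[OF subspace_tnull trep_tclass, of r n f]
  by (simp add: tscale_def tclass_eq_iff algebra_simps)

lemma tsum_class: "tsum n (\<lambda>i. tclass n (f i)) I = tclass n (\<Sum>i\<in>I. f i)"
  unfolding tsum_def tclass_eq_iff sum_subtractf[symmetric]
  by (rule pm.subspace_sum[OF subspace_tnull trep_tclass])

lemma pm_extend_diff: "pm_extend g (f - f') = pm_extend g f - pm_extend g f'"
  by (rule module_hom.diff[OF module_hom_pm_extend])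

text \<open>A family that respects the multilinearity relations induces a map on tensor powers.\<close>

lemma pm_extend_tnull:
  assumes "\<And>xs i a b. length xs = n \<Longrightarrow> i < n \<Longrightarrow>
      g (xs[i := a + b]) - g (xs[i := a]) - g (xs[i := b]) \<in> tnull m"
    and "\<And>xs i r a. length xs = n \<Longrightarrow> i < n \<Longrightarrow>
      g (xs[i := scale r a]) - pm_scale r (g (xs[i := a])) \<in> tnull m"
    and "f \<in> tnull n"
  shows "pm_extend g f \<in> tnull m"
proof -
  have "pm.subspace {f. pm_extend g f \<in> tnull m}"
    using module_hom.subspace_vimage[OF module_hom_pm_extend subspace_tnull]
    by (simp add: vimage_def)
  then have "tnull n \<subseteq> {f. pm_extend g f \<in> tnull m}"
    unfolding tnull_def[of n]
    by (intro pm.span_minimal) (auto simp: trel_def pm_extend_diff assms(1,2))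
  then show ?thesis using assms(3) by auto
qed

lemma single_eq_pm_scale: "Poly_Mapping.single x r = pm_scale r (Poly_Mapping.single x 1)"
  by (rule poly_mapping_eqI) (simp add: lookup_single when_def)

lemma tnull_add:
  "length xs = n \<Longrightarrow> i < n \<Longrightarrow>
    Poly_Mapping.single (xs[i := a + b]) 1
      - Poly_Mapping.single (xs[i := a]) 1 - Poly_Mapping.single (xs[i := b]) 1 \<in> tnull n"
  unfolding tnull_def by (rule pm.span_base) (auto simp: trel_def)

lemma tnull_scale:
  "length xs = n \<Longrightarrow> i < n \<Longrightarrow>
    Poly_Mapping.single (xs[i := scale r a]) 1
      - pm_scale r (Poly_Mapping.single (xs[i := a]) 1) \<in> tnull n"
  unfolding tnull_def single_eq_pm_scale[symmetric]
  by (rule pm.span_base) (unfold trel_def, blast)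

lemma pm_extend_swap:
  "pm_extend (\<lambda>x. pm_extend (\<lambda>y. b x y) g) f = pm_extend (\<lambda>y. pm_extend (\<lambda>x. b x y) f) g"
  by (simp add: pm_extend_def pm.scale_sum_right mult.commute sum.swap[of _ "Poly_Mapping.keys f"])

lemma pm_extend_in_subspace:
  "pm.subspace V \<Longrightarrow> (\<And>x. x \<in> Poly_Mapping.keys f \<Longrightarrow> g x \<in> V) \<Longrightarrow> pm_extend g f \<in> V"
  unfolding pm_extend_def by (intro pm.subspace_sum pm.subspace_scale)

lemma bilinear_class:
  assumes f: "f' - f \<in> tnull m" and g: "g' - g \<in> tnull n"
    and free: "f \<in> tfree m" "g \<in> tfree n"
    and left: "\<And>ys h. length ys = n \<Longrightarrow> h \<in> tnull m \<Longrightarrow> pm_extend (\<lambda>xs. b xs ys) h \<in> tnull k"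
    and right: "\<And>xs h. length xs = m \<Longrightarrow> h \<in> tnull n \<Longrightarrow> pm_extend (\<lambda>ys. b xs ys) h \<in> tnull k"
  shows "tclass k (pm_extend (\<lambda>xs. pm_extend (b xs) g') f') =
    tclass k (pm_extend (\<lambda>xs. pm_extend (b xs) g) f)"
proof -
  let ?B = "\<lambda>f g. pm_extend (\<lambda>xs. pm_extend (b xs) g) f"
  have f': "f' \<in> tfree m"
    using pm.subspace_add[OF subspace_tfree _ free(1), of "f' - f"] f tnull_subset_tfree by auto
  have 1: "?B f' (g' - g) \<in> tnull k"
    using f' g by (intro pm_extend_in_subspace subspace_tnull right) (auto simp: tfree_def)
  have "pm_extend (\<lambda>ys. pm_extend (\<lambda>xs. b xs ys) (f' - f)) g \<in> tnull k"
    using free(2) f by (intro pm_extend_in_subspace subspace_tnull left) (auto simp: tfree_def)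
  then have 2: "?B (f' - f) g \<in> tnull k" by (subst pm_extend_swap)
  have "?B f' (g' - g) = ?B f' g' - ?B f' g"
    by (simp add: pm_extend_def[of _ f'] pm_extend_diff pm.scale_right_diff_distrib sum_subtractf)
  moreover have "?B (f' - f) g = ?B f' g - ?B f g" by (rule pm_extend_diff)
  ultimately show ?thesis
    using pm.subspace_add[OF subspace_tnull 1 2] by (simp add: tclass_eq_iff)
qed

lemma map2_update_left:
  "length xs = length ys \<Longrightarrow> i < length ys \<Longrightarrow>
    map2 (*) (xs[i := a]) ys = (map2 (*) xs ys)[i := a * ys ! i]"
  by (auto intro!: nth_equalityI simp: nth_list_update)

lemma map2_update_right:
  "length xs = length ys \<Longrightarrow> i < length ys \<Longrightarrow>
    map2 (*) xs (ys[i := a]) = (map2 (*) xs ys)[i := xs ! i * a]"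
  by (auto intro!: nth_equalityI simp: nth_list_update)

lemma tmult_class:
  assumes "f \<in> tfree n" "g \<in> tfree n"
  shows "tmult n (tclass n f) (tclass n g) = tclass n (fmult f g)"
  unfolding tmult_def fmult_def
proof (rule bilinear_class[OF trep_tclass trep_tclass assms])
  fix ys :: "'a list" and h :: "'a list \<Rightarrow>\<^sub>0 'r"
  assume "length ys = n" "h \<in> tnull n"
  then show "pm_extend (\<lambda>xs. Poly_Mapping.single (map2 (*) xs ys) 1) h \<in> tnull n"
    by (intro pm_extend_tnull[where n = n])
      (auto simp: map2_update_left distrib_right scale_mult_left tnull_add tnull_scale)
next
  fix xs :: "'a list" and h :: "'a list \<Rightarrow>\<^sub>0 'r"
  assume "length xs = n" "h \<in> tnull n"
  then show "pm_extend (\<lambda>ys. Poly_Mapping.single (map2 (*) xs ys) 1) h \<in> tnull n"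
    by (intro pm_extend_tnull[where n = n])
      (auto simp: map2_update_right distrib_left scale_mult_right tnull_add tnull_scale)
qed

lemma tmult_pure:
  "length xs = n \<Longrightarrow> length ys = n \<Longrightarrow> tmult n (tpure xs) (tpure ys) = tpure (map2 (*) xs ys)"
  by (simp add: tpure_def tmult_class fmult_def)

lemma tappend_class:
  assumes "f \<in> tfree m" "g \<in> tfree n"
  shows "tappend m n (tclass m f) (tclass n g) = tclass (m + n) (fappend f g)"
  unfolding tappend_def fappend_def
proof (rule bilinear_class[OF trep_tclass trep_tclass assms])
  fix ys :: "'a list" and h :: "'a list \<Rightarrow>\<^sub>0 'r"
  assume ys: "length ys = n" and h: "h \<in> tnull m"
  have upd: "xs[i := a] @ ys = (xs @ ys)[i := a]" if "i < length xs" for xs i and a :: 'a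
    using that by (simp add: list_update_append)
  show "pm_extend (\<lambda>xs. Poly_Mapping.single (xs @ ys) 1) h \<in> tnull (m + n)"
    using ys by (intro pm_extend_tnull[OF _ _ h]) (simp_all add: upd tnull_add tnull_scale)
next
  fix xs :: "'a list" and h :: "'a list \<Rightarrow>\<^sub>0 'r"
  assume xs: "length xs = m" and h: "h \<in> tnull n"
  have upd: "xs @ ys[i := a] = (xs @ ys)[m + i := a]" for ys i and a :: 'a
    using xs by (simp add: list_update_append)
  show "pm_extend (\<lambda>ys. Poly_Mapping.single (xs @ ys) 1) h \<in> tnull (m + n)"
    using xs by (intro pm_extend_tnull[OF _ _ h]) (simp_all add: upd tnull_add tnull_scale)
qed

lemma tappend_pure:
  "length xs = m \<Longrightarrow> length ys = n \<Longrightarrow> tappend m n (tpure xs) (tpure ys) = tpure (xs @ ys)"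
  by (simp add: tpure_def tappend_class fappend_def)

lemma permute_list_update:
  assumes "\<sigma> permutes {..<length xs}" "i < length xs"
  shows "permute_list (inv \<sigma>) (xs[i := a]) = (permute_list (inv \<sigma>) xs)[\<sigma> i := a]"
proof (rule nth_equalityI)
  fix j assume "j < length (permute_list (inv \<sigma>) (xs[i := a]))"
  then have j: "j < length xs" by simp
  have p: "inv \<sigma> permutes {..<length xs}" by (rule permutes_inv[OF assms(1)])
  have "inv \<sigma> j < length xs" using permutes_in_image[OF p, of j] j by simp
  moreover have "\<sigma> i = j \<longleftrightarrow> i = inv \<sigma> j"
    using permutes_inverses[OF assms(1)] by metis
  ultimately show "permute_list (inv \<sigma>) (xs[i := a]) ! j = (permute_list (inv \<sigma>) xs)[\<sigma> i := a] ! j"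
    using j p by (auto simp: permute_list_nth nth_list_update)
qed simp

lemma tperm_class:
  assumes "\<sigma> permutes {..<n}"
  shows "tperm n \<sigma> (tclass n f) =
    tclass n (pm_extend (\<lambda>xs. Poly_Mapping.single (permute_list (inv \<sigma>) xs) 1) f)"
proof -
  have "\<sigma> i < n" if "i < n" for i using permutes_in_image[OF assms, of i] that by simp
  then show ?thesis
    unfolding tperm_def tclass_eq_iff pm_extend_diff[symmetric]
    using assms
    by (intro pm_extend_tnull[OF _ _ trep_tclass])
      (simp_all add: permute_list_update tnull_add tnull_scale)
qed

lemma tperm_pure:
  "\<sigma> permutes {..<n} \<Longrightarrow> length xs = n \<Longrightarrow>
    tperm n \<sigma> (tpure xs) = tpure (permute_list (inv \<sigma>) xs)"
  by (simp add: tpure_def tperm_class)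

lemma tpure_in_tpow [simp]: "length xs = n \<Longrightarrow> tpure xs \<in> tpow n"
  by (auto simp: tpure_def tpow_def)

lemma tpure_add:
  "length xs = n \<Longrightarrow> i < n \<Longrightarrow>
    tpure (xs[i := a + b]) = tadd n (tpure (xs[i := a])) (tpure (xs[i := b]))"
  using tnull_add[of xs n i a b] by (simp add: tpure_def tadd_class tclass_eq_iff algebra_simps)

lemma tpure_scale:
  "length xs = n \<Longrightarrow> i < n \<Longrightarrow> tpure (xs[i := scale r a]) = tscale n r (tpure (xs[i := a]))"
  using tnull_scale[of xs n i r a] by (simp add: tpure_def tscale_class tclass_eq_iff)

lemma fappend_in_tfree: "f \<in> tfree m \<Longrightarrow> g \<in> tfree n \<Longrightarrow> fappend f g \<in> tfree (m + n)"
  unfolding fappend_def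
  by (intro pm_extend_in_subspace subspace_tfree) (auto simp: tfree_def)

lemma tappend_in_tpow: "S \<in> tpow m \<Longrightarrow> T \<in> tpow n \<Longrightarrow> tappend m n S T \<in> tpow (m + n)"
  by (simp add: tappend_def tpow_def fappend_in_tfree trep_in_tfree[unfolded tpow_def])

lemma fappend_add_left: "fappend (f + f') g = fappend f g + fappend f' g"
  by (simp add: fappend_def pm_extend_add)

lemma fappend_scale_left: "fappend (pm_scale r f) g = pm_scale r (fappend f g)"
  by (simp add: fappend_def pm_extend_scale)

lemma fappend_add_right: "fappend f (g + g') = fappend f g + fappend f g'"
  unfolding fappend_def pm_extend_swap[of _ _ f] by (rule pm_extend_add)

lemma fappend_scale_right: "fappend f (pm_scale r g) = pm_scale r (fappend f g)"
  unfolding fappend_def pm_extend_swap[of _ _ f] by (rule pm_extend_scale)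

lemma tappend_add_left:
  assumes "S \<in> tpow m" "S' \<in> tpow m" "T \<in> tpow n"
  shows "tappend m n (tadd m S S') T = tadd (m + n) (tappend m n S T) (tappend m n S' T)"
  using assms
  by (auto simp: tpow_def tadd_class tappend_class fappend_add_left
      pm.subspace_add[OF subspace_tfree])

lemma tappend_add_right:
  assumes "S \<in> tpow m" "T \<in> tpow n" "T' \<in> tpow n"
  shows "tappend m n S (tadd n T T') = tadd (m + n) (tappend m n S T) (tappend m n S T')"
  using assms
  by (auto simp: tpow_def tadd_class tappend_class fappend_add_right
      pm.subspace_add[OF subspace_tfree])

lemma tappend_scale_left:
  assumes "S \<in> tpow m" "T \<in> tpow n"
  shows "tappend m n (tscale m r S) T = tscale (m + n) r (tappend m n S T)"
  using assms
  by (auto simp: tpow_def tscale_class tappend_class fappend_scale_left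
      pm.subspace_scale[OF subspace_tfree])

lemma tappend_scale_right:
  assumes "S \<in> tpow m" "T \<in> tpow n"
  shows "tappend m n S (tscale n r T) = tscale (m + n) r (tappend m n S T)"
  using assms
  by (auto simp: tpow_def tscale_class tappend_class fappend_scale_right
      pm.subspace_scale[OF subspace_tfree])

lemma trep_tadd: "trep (tadd n S T) - trep S - trep T \<in> tnull n"
  using trep_tclass[of n "trep S + trep T"] by (simp add: tadd_def algebra_simps)

lemma trep_tscale: "trep (tscale n r S) - pm_scale r (trep S) \<in> tnull n"
  using trep_tclass[of n "pm_scale r (trep S)"] by (simp add: tscale_def)

lemma tmap_class:
  assumes \<phi>: "tlinear m m' \<phi>" and \<psi>: "tlinear n n' \<psi>"
  shows "tmap m m' n n' \<phi> \<psi> (tclass (m + n) f) =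
    tclass (m' + n')
      (pm_extend (\<lambda>xs. trep (tappend m' n' (\<phi> (tpure (take m xs))) (\<psi> (tpure (drop m xs))))) f)"
proof -
  let ?G = "\<lambda>xs. tappend m' n' (\<phi> (tpure (take m xs))) (\<psi> (tpure (drop m xs)))"
  have in_\<phi>: "\<phi> (tpure xs) \<in> tpow m'" if "length xs = m" for xs
    using \<phi> that by (simp add: tlinear_def)
  have in_\<psi>: "\<psi> (tpure xs) \<in> tpow n'" if "length xs = n" for xs
    using \<psi> that by (simp add: tlinear_def)
  have add: "?G (xs[i := a + b]) = tadd (m' + n') (?G (xs[i := a])) (?G (xs[i := b]))"
    if "length xs = m + n" "i < m + n" for xs i a b
  proof (cases "i < m")
    case True
    then have "\<phi> (tpure (take m (xs[i := a + b]))) =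
        tadd m' (\<phi> (tpure (take m (xs[i := a])))) (\<phi> (tpure (take m (xs[i := b]))))"
      using that \<phi> by (simp add: take_update_swap tpure_add[of _ m] tlinear_def)
    then show ?thesis
      using True that by (simp add: tappend_add_left in_\<phi> in_\<psi>)
  next
    case False
    then have "\<psi> (tpure (drop m (xs[i := a + b]))) =
        tadd n' (\<psi> (tpure (drop m (xs[i := a])))) (\<psi> (tpure (drop m (xs[i := b]))))"
      using that \<psi> by (simp add: drop_update_swap tpure_add[of _ n] tlinear_def)
    then show ?thesis
      using False that by (simp add: tappend_add_right in_\<phi> in_\<psi>)
  qed
  have scl: "?G (xs[i := scale r a]) = tscale (m' + n') r (?G (xs[i := a]))"
    if "length xs = m + n" "i < m + n" for xs i r a
  proof (cases "i < m")
    case True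
    then have "\<phi> (tpure (take m (xs[i := scale r a]))) = tscale m' r (\<phi> (tpure (take m (xs[i := a]))))"
      using that \<phi> by (simp add: take_update_swap tpure_scale[of _ m] tlinear_def)
    then show ?thesis
      using True that by (simp add: tappend_scale_left in_\<phi> in_\<psi>)
  next
    case False
    then have "\<psi> (tpure (drop m (xs[i := scale r a]))) = tscale n' r (\<psi> (tpure (drop m (xs[i := a]))))"
      using that \<psi> by (simp add: drop_update_swap tpure_scale[of _ n] tlinear_def)
    then show ?thesis
      using False that by (simp add: tappend_scale_right in_\<phi> in_\<psi>)
  qed
  show ?thesis
    unfolding tmap_def tclass_eq_iff pm_extend_diff[symmetric]
    by (rule pm_extend_tnull[OF _ _ trep_tclass]) (simp_all add: add scl trep_tadd trep_tscale)
qed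

lemma tmap_pure:
  assumes "tlinear m m' \<phi>" "tlinear n n' \<psi>" "length xs = m" "length ys = n"
  shows "tmap m m' n n' \<phi> \<psi> (tpure (xs @ ys)) = tappend m' n' (\<phi> (tpure xs)) (\<psi> (tpure ys))"
proof -
  have "\<phi> (tpure xs) \<in> tpow m'" "\<psi> (tpure ys) \<in> tpow n'"
    using assms by (simp_all add: tlinear_def)
  then show ?thesis
    using tmap_class[OF assms(1,2), of "Poly_Mapping.single (xs @ ys) 1"] assms(3,4)
    by (simp add: tpure_def[of "xs @ ys"] tclass_trep tappend_in_tpow)
qed

end

section \<open>Polynomial algebras\<close>

text \<open>
  Polynomials with variables indexed by \<open>'v\<close> and coefficients in \<open>'r\<close>: the inner
  \<open>'v \<Rightarrow>\<^sub>0 nat\<close> is the type of monomials (exponent vectors).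
\<close>

type_synonym ('v, 'r) mpoly = "('v \<Rightarrow>\<^sub>0 nat) \<Rightarrow>\<^sub>0 'r"

interpretation mpoly: assoc_algebra
  "pm_scale :: 'r::comm_ring_1 \<Rightarrow> ('v, 'r) mpoly \<Rightarrow> ('v, 'r) mpoly"
proof
  fix r :: 'r and a b :: "('v, 'r) mpoly"
  have *: "pm_scale r p = Poly_Mapping.single 0 r * p" for p :: "('v, 'r) mpoly"
    by (simp add: pm_scale_def mult_map_scale_conv_mult)
  show "pm_scale r a * b = pm_scale r (a * b)" by (simp add: * mult.assoc)
  show "a * pm_scale r b = pm_scale r (a * b)" by (simp add: * mult.left_commute)
qed

end

theory Submission
  imports Defs
begin

text \<open>
  Identify the \<open>n\<close>-th tensor power of \<open>A = R[t\<^sub>1, \<dots>, t\<^sub>d]\<close> with the polynomial ring in the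
  variables \<open>(i, v)\<close>, where \<open>i\<close> is a tensor position and \<open>v\<close> a variable of \<open>A\<close>
  (\<open>tens_poly\<close>, injective by \<open>tens_poly_eq_0_imp\<close>), and write \<open>a\<^sub>i\<close> for \<open>a\<close> placed at
  position \<open>i\<close>.  Because \<open>A\<close> is commutative, expanding \<open>\<phi>(c \<otimes> ab) = \<phi>(c \<otimes> ba)\<close> by the
  derivation rule gives
  \<open>(a\<^sub>0 - a\<^sub>1) \<phi>(c \<otimes> b) = (b\<^sub>0 - b\<^sub>1) \<phi>(c \<otimes> a)\<close>.
  For two different variables \<open>a\<close> and \<open>b\<close>, the differences \<open>a\<^sub>0 - a\<^sub>1\<close> and \<open>b\<^sub>0 - b\<^sub>1\<close> are
  non-zero-divisors and each remains one modulo the other, over every coefficient ring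
  (\<open>var_diff_mult_eq_0\<close>, \<open>var_diff_dvd_of_dvd_mult\<close>); this is where two variables are used.  Together with skew symmetry
  it follows that
  \<open>\<phi>(a \<otimes> b) = (a\<^sub>0 - a\<^sub>1) (b\<^sub>0 - b\<^sub>1) g\<close>
  for one skew-symmetric element \<open>g\<close> (\<open>eq_slot_diff_mult_slot_diff_mult\<close>).

  For a bracket of this form the double Jacobiator at \<open>x \<otimes> x \<otimes> x\<close>, \<open>x\<close> a variable, is
  \<open>(x\<^sub>0 - x\<^sub>1) (x\<^sub>1 - x\<^sub>2) (x\<^sub>0 - x\<^sub>2) (g\<^bsub>01\<^esub> g\<^bsub>02\<^esub> - g\<^bsub>01\<^esub> g\<^bsub>12\<^esub> + g\<^bsub>02\<^esub> g\<^bsub>12\<^esub>)\<close>,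
  where \<open>g\<^bsub>ij\<^esub>\<close> is \<open>g\<close> placed at the positions \<open>i\<close> and \<open>j\<close>.  If it vanishes, then so does the
  last factor; identifying position 2 with position 1 turns this factor into \<open>g\<^bsub>01\<^esub>\<close> squared.  A
  polynomial ring over a ring without nilpotent elements has none either (\<open>mpoly_reduced\<close>),
  whence \<open>g = 0\<close> and \<open>\<phi> = 0\<close>.
\<close>

section \<open>Pushing finitely supported functions forward\<close>

lemma poly_mapping_expand:
  "f = (\<Sum>k\<in>Poly_Mapping.keys f. Poly_Mapping.single k (Poly_Mapping.lookup f k))"
  by (rule poly_mapping_eqI) (simp add: lookup_sum lookup_single when_def in_keys_iff)

lemma poly_mapping_single_induct [case_names single add]:
  fixes f :: "'k \<Rightarrow>\<^sub>0 'c::comm_monoid_add"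
  assumes "\<And>k c. P (Poly_Mapping.single k c)"
    and "\<And>f g. P f \<Longrightarrow> P g \<Longrightarrow> P (f + g)"
  shows "P f"
proof -
  have "P (\<Sum>k\<in>K. Poly_Mapping.single k (Poly_Mapping.lookup f k))" if "finite K" for K
    using that assms(1)[of undefined 0] by (induction K) (simp_all add: assms)
  then show ?thesis by (subst poly_mapping_expand) simp
qed

definition push :: "('x \<Rightarrow> 'y) \<Rightarrow> ('x \<Rightarrow>\<^sub>0 'c) \<Rightarrow> ('y \<Rightarrow>\<^sub>0 'c::comm_monoid_add)" where
  "push h f = (\<Sum>x\<in>Poly_Mapping.keys f. Poly_Mapping.single (h x) (Poly_Mapping.lookup f x))"

lemma push_zero [simp]: "push h 0 = 0"
  by (simp add: push_def)

lemma push_single [simp]: "push h (Poly_Mapping.single x c) = Poly_Mapping.single (h x) c"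
  by (cases "c = 0") (simp_all add: push_def)

lemma push_add: "push h (f + g) = push h f + push h g"
proof -
  let ?S = "Poly_Mapping.keys f \<union> Poly_Mapping.keys g"
  have *: "push h k = (\<Sum>x\<in>?S. Poly_Mapping.single (h x) (Poly_Mapping.lookup k x))"
    if "Poly_Mapping.keys k \<subseteq> ?S" for k
    unfolding push_def
    by (rule sum.mono_neutral_left) (use that in \<open>auto simp: in_keys_iff\<close>)
  show ?thesis
    using keys_add[of f g] by (simp add: * lookup_add single_add sum.distrib)
qed

text \<open>
  A homomorphism of monoids induces a homomorphism of monoid algebras.
\<close>

lemma push_mult:
  assumes w: "\<And>k l. w (k + l) = w k + w l"
  shows "push w (f * g :: 'm::comm_monoid_add \<Rightarrow>\<^sub>0 'c::comm_semiring_1) = push w f * push w g"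
proof (induction f rule: poly_mapping_single_induct)
  case (single k c)
  show ?case
    by (induction g rule: poly_mapping_single_induct)
      (simp_all add: mult_single w push_add distrib_left)
qed (simp add: push_add distrib_right)

section \<open>Renaming the variables of a polynomial\<close>

text \<open>
  The inner \<open>push\<close> acts on exponent vectors, the outer one on polynomials as finitely supported
  functions of exponent vectors.
\<close>

definition rename :: "('x \<Rightarrow> 'y) \<Rightarrow> ('x, 'r::comm_ring_1) mpoly \<Rightarrow> ('y, 'r) mpoly" where
  "rename h = push (push h)"

definition const :: "'r::comm_ring_1 \<Rightarrow> ('x, 'r) mpoly" where
  "const r = Poly_Mapping.single 0 r"

definition var :: "'x \<Rightarrow> ('x, 'r::comm_ring_1) mpoly" where
  "var x = Poly_Mapping.single (Poly_Mapping.single x 1) 1"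

lemma pm_scale_eq_const_mult: "pm_scale r f = const r * f" for f :: "('x, 'r::comm_ring_1) mpoly"
  by (simp add: pm_scale_def const_def mult_map_scale_conv_mult)

lemma pm_scale_mult_left: "pm_scale r f * g = pm_scale r (f * g)"
  for f :: "('x, 'r::comm_ring_1) mpoly"
  by (simp add: pm_scale_eq_const_mult mult.assoc)

lemma pm_scale_mult_right: "f * pm_scale r g = pm_scale r (f * g)"
  for f :: "('x, 'r::comm_ring_1) mpoly"
  by (simp add: pm_scale_eq_const_mult mult.left_commute)

lemma mpoly_induct [case_names const var add mult]:
  fixes f :: "('x, 'r::comm_ring_1) mpoly"
  assumes const: "\<And>r. P (const r)" and var: "\<And>x. P (var x)"
    and add: "\<And>f g. P f \<Longrightarrow> P g \<Longrightarrow> P (f + g)" and mult: "\<And>f g. P f \<Longrightarrow> P g \<Longrightarrow> P (f * g)"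
  shows "P f"
proof -
  have pow: "P (Poly_Mapping.single (Poly_Mapping.single x n) 1)" for x n
  proof (induction n)
    case 0
    then show ?case using const[of 1] by (simp add: const_def)
  next
    case (Suc n)
    have "Poly_Mapping.single (Poly_Mapping.single x (Suc n)) 1
        = var x * (Poly_Mapping.single (Poly_Mapping.single x n) 1 :: ('x, 'r) mpoly)"
      by (simp add: var_def mult_single single_add[symmetric])
    then show ?case using mult[OF var Suc] by simp
  qed
  have monom: "P (Poly_Mapping.single m 1)" for m
  proof (induction m rule: poly_mapping_single_induct)
    case (single x n)
    then show ?case by (rule pow)
  next
    case (add m m')
    have "Poly_Mapping.single (m + m') 1
        = (Poly_Mapping.single m 1 * Poly_Mapping.single m' 1 :: ('x, 'r) mpoly)"
      by (simp add: mult_single)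
    then show ?case using mult[OF add] by simp
  qed
  show ?thesis
  proof (induction f rule: poly_mapping_single_induct)
    case (single m r)
    have "Poly_Mapping.single m r = const r * (Poly_Mapping.single m 1 :: ('x, 'r) mpoly)"
      by (simp add: const_def mult_single)
    then show ?case using mult[OF const monom] by simp
  qed (rule add)
qed

lemma rename_add: "rename h (f + g) = rename h f + rename h g"
  by (simp add: rename_def push_add)

lemma rename_mult: "rename h (f * g) = rename h f * rename h g"
  unfolding rename_def by (rule push_mult) (rule push_add)

lemma rename_const [simp]: "rename h (const r) = const r"
  by (simp add: rename_def const_def)

lemma rename_var [simp]: "rename h (var x) = var (h x)"
  by (simp add: rename_def var_def)

lemma rename_monomial [simp]:
  "rename h (Poly_Mapping.single m r) = Poly_Mapping.single (push h m) r"
  by (simp add: rename_def)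

lemma rename_scale: "rename h (pm_scale r f) = pm_scale r (rename h f)"
  by (simp add: pm_scale_eq_const_mult rename_mult)

lemma module_hom_rename: "module_hom pm_scale pm_scale (rename h)"
  by standard (simp_all add: rename_add rename_scale)

lemma rename_zero [simp]: "rename h 0 = 0"
  using rename_const[of h 0] by (simp add: const_def)

lemma rename_one [simp]: "rename h 1 = 1"
  using rename_const[of h 1] by (simp add: const_def)

lemma rename_diff: "rename h (f - g) = rename h f - rename h g"
  by (rule module_hom.diff[OF module_hom_rename])

lemma rename_uminus: "rename h (- f) = - rename h f"
  by (rule module_hom.neg[OF module_hom_rename])

lemma rename_sum: "rename h (\<Sum>i\<in>I. f i) = (\<Sum>i\<in>I. rename h (f i))"
  by (rule module_hom.sum[OF module_hom_rename])

lemma rename_prod: "rename h (\<Prod>i\<in>I. f i) = (\<Prod>i\<in>I. rename h (f i))"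
  by (induction I rule: infinite_finite_induct) (simp_all add: rename_mult)

lemma rename_pm_extend: "rename h (pm_extend g f) = pm_extend (\<lambda>x. rename h (g x)) f"
  by (simp add: pm_extend_def rename_sum rename_scale)

lemma rename_rename: "rename g (rename h f) = rename (g \<circ> h) f"
  by (induction f rule: mpoly_induct) (simp_all add: rename_add rename_mult)

section \<open>Differences of variables\<close>

text \<open>
  Identifying the variables \<open>a\<close> and \<open>b\<close> is reduction modulo \<open>var a - var b\<close>; divisibility by this
  difference can therefore be tested by a renaming.
\<close>

lemma var_diff_dvd_diff_rename: "var a - var b dvd f - rename (id(a := b)) f"
proof (induction f rule: mpoly_induct)
  case (add f g)
  then have "var a - var b dvd (f - rename (id(a := b)) f) + (g - rename (id(a := b)) g)"
    by (rule dvd_add)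
  then show ?case by (simp only: rename_add add_diff_add)
next
  case (mult f g)
  let ?s = "rename (id(a := b))"
  have "f * g - ?s (f * g) = (f - ?s f) * g + ?s f * (g - ?s g)"
    by (simp add: rename_mult algebra_simps)
  then show ?case using mult by (metis dvd_add dvd_mult dvd_mult2)
qed (auto simp: id_def)

lemma lookup_monomial_mult_shift:
  "Poly_Mapping.lookup (Poly_Mapping.single k 1 * f) (k + m) = Poly_Mapping.lookup f m"
  for f :: "('x, 'r::comm_ring_1) mpoly"
  by (induction f rule: poly_mapping_single_induct)
    (simp_all add: mult_single lookup_single distrib_left lookup_add)

lemma lookup_monomial_mult_outside:
  fixes f :: "('x, 'r::comm_ring_1) mpoly"
  assumes "\<And>q. m \<noteq> k + q"
  shows "Poly_Mapping.lookup (Poly_Mapping.single k 1 * f) m = 0"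
proof (induction f rule: poly_mapping_single_induct)
  case (single q c)
  then show ?case using assms[of q] by (simp add: mult_single lookup_single when_def)
qed (simp add: distrib_left lookup_add)

text \<open>
  The ring of coefficients may have zero divisors, so the cancellation is done on coefficients:
  if \<open>var a * f = var b * f\<close>, then moving one factor \<open>b\<close> of a monomial to \<open>a\<close> does not change
  its coefficient in \<open>f\<close>, and a monomial without the variable \<open>b\<close> has coefficient zero.
  Induction on the exponent of \<open>b\<close> shows that all coefficients vanish.
\<close>

lemma var_diff_mult_eq_0:
  assumes "a \<noteq> b" and "(var a - var b) * f = 0"
  shows "f = 0"
proof -
  have eq: "var a * f = var b * f" using assms(2) by (simp add: algebra_simps)
  have "\<forall>m. Poly_Mapping.lookup m b = n \<longrightarrow> Poly_Mapping.lookup f m = 0" for n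
  proof (induction n)
    case 0
    show ?case
    proof (intro allI impI)
      fix m :: "'a \<Rightarrow>\<^sub>0 nat" assume m: "Poly_Mapping.lookup m b = 0"
      have "Poly_Mapping.lookup (Poly_Mapping.single a 1 + m) b = 0"
        using m assms(1) by (simp add: lookup_add lookup_single)
      then have "Poly_Mapping.single a 1 + m \<noteq> Poly_Mapping.single b 1 + q" for q
        by (metis lookup_add lookup_single_eq add_is_0 one_neq_zero)
      then have "Poly_Mapping.lookup (var b * f) (Poly_Mapping.single a 1 + m) = 0"
        unfolding var_def by (rule lookup_monomial_mult_outside)
      then show "Poly_Mapping.lookup f m = 0"
        unfolding eq[symmetric] by (simp add: var_def lookup_monomial_mult_shift)
    qed
  next
    case (Suc n)
    show ?case
    proof (intro allI impI)
      fix m :: "'a \<Rightarrow>\<^sub>0 nat" assume m: "Poly_Mapping.lookup m b = Suc n"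
      define q where "q = m - Poly_Mapping.single b 1"
      have mq: "m = Poly_Mapping.single b 1 + q"
        using m by (intro poly_mapping_eqI) (auto simp: q_def lookup_add lookup_minus lookup_single when_def)
      then have "Poly_Mapping.lookup q b = n"
        using m by (simp add: lookup_add)
      then have "Poly_Mapping.lookup (Poly_Mapping.single a 1 + q) b = n"
        using assms(1) by (simp add: lookup_add lookup_single)
      moreover have "Poly_Mapping.lookup f m
          = Poly_Mapping.lookup (var a * f) (Poly_Mapping.single a 1 + m)"
        by (simp add: var_def lookup_monomial_mult_shift)
      moreover have "\<dots> = Poly_Mapping.lookup (var b * f)
          (Poly_Mapping.single b 1 + (Poly_Mapping.single a 1 + q))"
        unfolding eq mq by (simp add: add.left_commute)
      moreover have "\<dots> = Poly_Mapping.lookup f (Poly_Mapping.single a 1 + q)"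
        by (simp add: var_def lookup_monomial_mult_shift)
      ultimately show "Poly_Mapping.lookup f m = 0" using Suc by simp
    qed
  qed
  then show ?thesis by (intro poly_mapping_eqI) simp
qed

lemma var_diff_mult_cancel:
  "a \<noteq> b \<Longrightarrow> (var a - var b) * f = (var a - var b) * g \<Longrightarrow> f = g"
  using var_diff_mult_eq_0[of a b "f - g"] by (simp add: right_diff_distrib)

text \<open>
  Identifying \<open>a\<close> with \<open>b\<close> annihilates the multiple of \<open>f\<close> but fixes the factor
  \<open>var c - var e\<close>, which can then be cancelled.
\<close>

lemma var_diff_dvd_of_dvd_mult:
  fixes f :: "('x, 'r::comm_ring_1) mpoly"
  assumes "c \<noteq> e" "a \<notin> {c, e}" and dvd: "var a - var b dvd (var c - var e) * f"
  shows "var a - var b dvd f"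
proof -
  let ?s = "rename (id(a := b)) :: ('x, 'r) mpoly \<Rightarrow> _"
  obtain k where k: "(var c - var e) * f = (var a - var b) * k" using dvd by (elim dvdE)
  have "(var c - var e) * ?s f = ?s ((var c - var e) * f)"
    using assms(2) by (auto simp: rename_mult rename_diff)
  also have "\<dots> = 0" unfolding k by (simp add: rename_mult rename_diff)
  finally have "?s f = 0" using var_diff_mult_eq_0[OF assms(1)] by blast
  then show ?thesis using var_diff_dvd_diff_rename[of a b f] by simp
qed

section \<open>Polynomials over a reduced ring\<close>

text \<open>
  Passing to the elements of \<open>S\<close> with maximal exponent at one variable after the other
  leaves a vertex of the convex hull of \<open>S\<close>, which is not the midpoint of two other elements.
  At such an exponent the square of a polynomial with support \<open>S\<close> has just one contribution.
\<close>

lemma exists_extreme_exponent: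
  fixes S :: "('x \<Rightarrow>\<^sub>0 nat) set"
  assumes "finite S" "S \<noteq> {}"
  obtains k where "k \<in> S" "\<And>l q. l \<in> S \<Longrightarrow> q \<in> S \<Longrightarrow> l + q = k + k \<Longrightarrow> l = k \<and> q = k"
proof -
  have ex: "\<exists>k\<in>S. \<forall>l\<in>S. \<forall>q\<in>S. l + q = k + k \<longrightarrow>
      (\<forall>x\<in>V. Poly_Mapping.lookup l x = Poly_Mapping.lookup k x
        \<and> Poly_Mapping.lookup q x = Poly_Mapping.lookup k x)"
    if "finite V" "finite S" "S \<noteq> {}" for V and S :: "('x \<Rightarrow>\<^sub>0 nat) set"
    using that
  proof (induction V arbitrary: S)
    case (insert v V)
    define M where "M = Max ((\<lambda>l. Poly_Mapping.lookup l v) ` S)"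
    define S' where "S' = {l \<in> S. Poly_Mapping.lookup l v = M}"
    have le: "Poly_Mapping.lookup l v \<le> M" if "l \<in> S" for l
      unfolding M_def using that insert.prems by simp
    have "M \<in> (\<lambda>l. Poly_Mapping.lookup l v) ` S"
      unfolding M_def using insert.prems by (intro Max_in) auto
    then have "finite S'" "S' \<noteq> {}" using insert.prems by (auto simp: S'_def)
    from insert.IH[OF this] obtain k where k: "k \<in> S'"
      and IH: "\<And>l q. l \<in> S' \<Longrightarrow> q \<in> S' \<Longrightarrow> l + q = k + k \<Longrightarrow>
        (\<forall>x\<in>V. Poly_Mapping.lookup l x = Poly_Mapping.lookup k x
          \<and> Poly_Mapping.lookup q x = Poly_Mapping.lookup k x)"
      by blast
    show ?case
    proof (intro bexI[of _ k] ballI impI)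
      show "k \<in> S" using k by (simp add: S'_def)
      fix l q x assume lq: "l \<in> S" "q \<in> S" "l + q = k + k" and x: "x \<in> insert v V"
      have "Poly_Mapping.lookup l v + Poly_Mapping.lookup q v = M + M"
        using arg_cong[OF lq(3), of "\<lambda>m. Poly_Mapping.lookup m v"] k
        by (simp add: lookup_add S'_def)
      then have "Poly_Mapping.lookup l v = M" "Poly_Mapping.lookup q v = M"
        using le[OF lq(1)] le[OF lq(2)] by linarith+
      moreover from this have "l \<in> S'" "q \<in> S'" using lq(1,2) by (simp_all add: S'_def)
      moreover have "Poly_Mapping.lookup k v = M" using k by (simp add: S'_def)
      ultimately show "Poly_Mapping.lookup l x = Poly_Mapping.lookup k x
          \<and> Poly_Mapping.lookup q x = Poly_Mapping.lookup k x"
        using IH[OF _ _ lq(3)] x by (cases "x = v") simp_all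
    qed
  qed blast
  define V where "V = (\<Union>l\<in>S. Poly_Mapping.keys l)"
  have "finite V" using assms(1) by (simp add: V_def)
  from ex[OF this assms] obtain k where k: "k \<in> S"
    and max: "\<And>l q x. l \<in> S \<Longrightarrow> q \<in> S \<Longrightarrow> l + q = k + k \<Longrightarrow> x \<in> V \<Longrightarrow>
      Poly_Mapping.lookup l x = Poly_Mapping.lookup k x
        \<and> Poly_Mapping.lookup q x = Poly_Mapping.lookup k x"
    by blast
  have outside: "Poly_Mapping.lookup l x = 0" if "l \<in> S" "x \<notin> V" for l x
    using that by (auto simp: V_def in_keys_iff)
  show thesis
  proof (rule that[OF k])
    fix l q assume lq: "l \<in> S" "q \<in> S" "l + q = k + k"
    show "l = k \<and> q = k"
    proof (intro conjI poly_mapping_eqI)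
      fix x
      show "Poly_Mapping.lookup l x = Poly_Mapping.lookup k x"
        using max[OF lq, of x] outside[of _ x] lq(1,2) k by (cases "x \<in> V") simp_all
      show "Poly_Mapping.lookup q x = Poly_Mapping.lookup k x"
        using max[OF lq, of x] outside[of _ x] lq(1,2) k by (cases "x \<in> V") simp_all
    qed
  qed
qed

lemma mpoly_reduced:
  fixes f :: "('x, 'r::comm_ring_1) mpoly"
  assumes reduced: "\<And>x::'r. x ^ 2 = 0 \<Longrightarrow> x = 0" and "f * f = 0"
  shows "f = 0"
proof (rule ccontr)
  assume "f \<noteq> 0"
  let ?K = "Poly_Mapping.keys f" and ?c = "Poly_Mapping.lookup f"
  obtain k where k: "k \<in> ?K"
    and ext: "\<And>l q. l \<in> ?K \<Longrightarrow> q \<in> ?K \<Longrightarrow> l + q = k + k \<Longrightarrow> l = k \<and> q = k"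
    using exists_extreme_exponent[of ?K] \<open>f \<noteq> 0\<close> by auto
  have "f * f = (\<Sum>l\<in>?K. \<Sum>q\<in>?K. Poly_Mapping.single (l + q) (?c l * ?c q))"
    by (subst (1 2) poly_mapping_expand[of f]) (simp add: sum_product mult_single)
  then have "Poly_Mapping.lookup (f * f) (k + k)
      = (\<Sum>l\<in>?K. \<Sum>q\<in>?K. if l + q = k + k then ?c l * ?c q else 0)"
    by (simp add: lookup_sum lookup_single when_def)
  also have "\<dots> = (\<Sum>l\<in>?K. \<Sum>q\<in>?K. if q = k then if l = k then ?c k * ?c k else 0 else 0)"
  proof (intro sum.cong refl)
    fix l q assume "l \<in> ?K" "q \<in> ?K"
    then have "l + q = k + k \<longleftrightarrow> l = k \<and> q = k" using ext by blast
    then show "(if l + q = k + k then ?c l * ?c q else 0)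
        = (if q = k then if l = k then ?c k * ?c k else 0 else 0)"
      by simp
  qed
  also have "\<dots> = ?c k * ?c k" using k by simp
  finally have "?c k ^ 2 = 0" using assms(2) by (simp add: power2_eq_square)
  then show False using reduced k by (auto simp: in_keys_iff)
qed

section \<open>Tensor powers of a polynomial algebra as polynomial rings\<close>

lemma pm_extend_cong:
  "(\<And>x. x \<in> Poly_Mapping.keys f \<Longrightarrow> g x = g' x) \<Longrightarrow> pm_extend g f = pm_extend g' f"
  by (simp add: pm_extend_def)

lemma pm_extend_pm_extend: "pm_extend h (pm_extend g f) = pm_extend (\<lambda>x. pm_extend h (g x)) f"
  by (simp add: pm_extend_def[of _ f] module_hom.sum[OF module_hom_pm_extend] pm_extend_scale)

lemma pm_extend_minus: "pm_extend (\<lambda>x. g x - h x) f = pm_extend g f - pm_extend h f"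
  by (simp add: pm_extend_def pm.scale_right_diff_distrib sum_subtractf)

lemma pm_extend_mult_left:
  "pm_extend (\<lambda>x. c * g x) f = c * (pm_extend g f :: ('x, 'r::comm_ring_1) mpoly)"
  by (simp add: pm_extend_def sum_distrib_left pm_scale_mult_right)

lemma pm_extend_mult_right:
  "pm_extend (\<lambda>x. g x * c) f = (pm_extend g f :: ('x, 'r::comm_ring_1) mpoly) * c"
  by (simp add: pm_extend_def sum_distrib_right pm_scale_mult_left)

abbreviation slot :: "nat \<Rightarrow> ('v, 'r::comm_ring_1) mpoly \<Rightarrow> (nat \<times> 'v, 'r) mpoly" where
  "slot i \<equiv> rename (Pair i)"

definition pure_poly :: "('v, 'r::comm_ring_1) mpoly list \<Rightarrow> (nat \<times> 'v, 'r) mpoly" where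
  "pure_poly xs = (\<Prod>i<length xs. slot i (xs ! i))"

text \<open>
  This realises the isomorphism of the \<open>n\<close>-th tensor power with the ring of polynomials in
  variables \<open>(i, v)\<close>, \<open>i < n\<close>, where \<open>i\<close> is the tensor position.  Taking all natural numbers
  as positions puts the tensor powers for all \<open>n\<close> into one ring and makes moving factors to other
  positions a renaming of variables.
\<close>

definition tens_poly :: "(('v, 'r::comm_ring_1) mpoly, 'r) tens \<Rightarrow> (nat \<times> 'v, 'r) mpoly" where
  "tens_poly S = pm_extend pure_poly (mpoly.trep S)"

lemma pure_poly_update:
  "i < length xs \<Longrightarrow>
    pure_poly (xs[i := a]) = slot i a * (\<Prod>j\<in>{..<length xs} - {i}. slot j (xs ! j))"
  by (simp add: pure_poly_def prod.remove[of "{..<length xs}" i])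

lemma pm_extend_pure_poly_tnull:
  "f \<in> mpoly.tnull n \<Longrightarrow> pm_extend pure_poly f = 0"
proof -
  have "pm.subspace {f. pm_extend pure_poly f = (0 :: (nat \<times> 'a, 'b) mpoly)}"
    by (rule module_hom.subspace_kernel[OF module_hom_pm_extend])
  moreover have "mpoly.trel n \<subseteq> {f. pm_extend pure_poly f = (0 :: (nat \<times> 'a, 'b) mpoly)}"
    by (auto simp: mpoly.trel_def mpoly.pm_extend_diff pure_poly_update rename_add rename_scale
        pm_scale_mult_left distrib_right)
  moreover assume "f \<in> mpoly.tnull n"
  ultimately show ?thesis
    using pm.span_minimal unfolding mpoly.tnull_def by blast
qed

lemma tens_poly_class [simp]: "tens_poly (mpoly.tclass n f) = pm_extend pure_poly f"
  using pm_extend_pure_poly_tnull[OF mpoly.trep_tclass[of n f]]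
  by (simp add: tens_poly_def mpoly.pm_extend_diff)

lemma tens_poly_pure [simp]: "tens_poly (mpoly.tpure xs) = pure_poly xs"
  by (simp add: mpoly.tpure_def)

lemma tens_poly_zero [simp]: "tens_poly (mpoly.tzero n) = 0"
  by (simp add: mpoly.tzero_def pm_extend_def)

lemma tens_poly_add: "tens_poly (mpoly.tadd n S T) = tens_poly S + tens_poly T"
  by (simp add: mpoly.tadd_def pm_extend_add tens_poly_def[symmetric])

lemma tens_poly_neg: "tens_poly (mpoly.tneg n S) = - tens_poly S"
  by (simp add: mpoly.tneg_def module_hom.neg[OF module_hom_pm_extend] tens_poly_def[symmetric])

lemma tens_poly_sum: "tens_poly (mpoly.tsum n F I) = (\<Sum>i\<in>I. tens_poly (F i))"
  by (simp add: mpoly.tsum_def module_hom.sum[OF module_hom_pm_extend] tens_poly_def[symmetric])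

lemma length_of_trep_key:
  "S \<in> mpoly.tpow n \<Longrightarrow> xs \<in> Poly_Mapping.keys (mpoly.trep S) \<Longrightarrow> length xs = n"
  using mpoly.trep_in_tfree[of S n] by (simp add: mpoly.tfree_def)

lemma pure_poly_map2:
  "length xs = length ys \<Longrightarrow> pure_poly (map2 (*) xs ys) = pure_poly xs * pure_poly ys"
  by (simp add: pure_poly_def rename_mult prod.distrib)

lemma tens_poly_mult:
  assumes "S \<in> mpoly.tpow n" "T \<in> mpoly.tpow n"
  shows "tens_poly (mpoly.tmult n S T) = tens_poly S * tens_poly T"
proof -
  have "tens_poly (mpoly.tmult n S T) = pm_extend (\<lambda>xs. pm_extend (\<lambda>ys. pure_poly (map2 (*) xs ys))
      (mpoly.trep T)) (mpoly.trep S)"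
    by (simp add: mpoly.tmult_def mpoly.fmult_def pm_extend_pm_extend)
  also have "\<dots> = pm_extend (\<lambda>xs. pm_extend (\<lambda>ys. pure_poly xs * pure_poly ys)
      (mpoly.trep T)) (mpoly.trep S)"
    using assms by (intro pm_extend_cong pure_poly_map2) (simp add: length_of_trep_key)
  also have "\<dots> = tens_poly S * tens_poly T"
    by (simp add: tens_poly_def pm_extend_mult_left pm_extend_mult_right)
  finally show ?thesis .
qed

lemma apfst_comp_Pair: "apfst h \<circ> Pair i = Pair (h i)"
  by auto

lemma pure_poly_append:
  "pure_poly (xs @ ys) = pure_poly xs * rename (apfst ((+) (length xs))) (pure_poly ys)"
proof -
  have *: "{..<m + n} = {..<m} \<union> (+) m ` {..<n}" for m n :: nat
  proof (intro set_eqI iffI)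
    fix x assume "x \<in> {..<m + n}"
    then show "x \<in> {..<m} \<union> (+) m ` {..<n}"
      by (cases "x < m") (auto intro!: image_eqI[of _ _ "x - m"])
  qed auto
  show ?thesis
    unfolding pure_poly_def length_append *
    by (subst prod.union_disjoint)
      (auto simp: prod.reindex nth_append rename_prod rename_rename apfst_comp_Pair intro!: prod.cong)
qed

lemma tens_poly_append:
  assumes "S \<in> mpoly.tpow m"
  shows "tens_poly (mpoly.tappend m n S T) = tens_poly S * rename (apfst ((+) m)) (tens_poly T)"
proof -
  have "tens_poly (mpoly.tappend m n S T) = pm_extend (\<lambda>xs. pm_extend (\<lambda>ys. pure_poly (xs @ ys))
      (mpoly.trep T)) (mpoly.trep S)"
    by (simp add: mpoly.tappend_def mpoly.fappend_def pm_extend_pm_extend)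
  also have "\<dots> = pm_extend (\<lambda>xs. pm_extend (\<lambda>ys. pure_poly xs * rename (apfst ((+) m)) (pure_poly ys))
      (mpoly.trep T)) (mpoly.trep S)"
    using assms by (intro pm_extend_cong) (simp add: length_of_trep_key pure_poly_append)
  also have "\<dots> = tens_poly S * rename (apfst ((+) m)) (tens_poly T)"
    by (simp add: tens_poly_def pm_extend_mult_left pm_extend_mult_right rename_pm_extend)
  finally show ?thesis .
qed

lemma pure_poly_permute:
  assumes \<sigma>: "\<sigma> permutes {..<length xs}"
  shows "pure_poly (permute_list (inv \<sigma>) xs) = rename (apfst \<sigma>) (pure_poly xs)"
proof -
  have "pure_poly (permute_list (inv \<sigma>) xs) = (\<Prod>i<length xs. slot i (xs ! inv \<sigma> i))"
    using permutes_inv[OF \<sigma>] by (simp add: pure_poly_def permute_list_nth)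
  also have "\<dots> = (\<Prod>i<length xs. slot (\<sigma> i) (xs ! i))"
    using prod.permute[OF \<sigma>, of "\<lambda>i. slot i (xs ! inv \<sigma> i)"]
    by (simp add: o_def permutes_inverses[OF \<sigma>])
  also have "\<dots> = rename (apfst \<sigma>) (pure_poly xs)"
    by (simp add: pure_poly_def rename_prod rename_rename apfst_comp_Pair)
  finally show ?thesis .
qed

lemma tens_poly_perm:
  assumes "\<sigma> permutes {..<n}" and "S \<in> mpoly.tpow n"
  shows "tens_poly (mpoly.tperm n \<sigma> S) = rename (apfst \<sigma>) (tens_poly S)"
proof -
  have "tens_poly (mpoly.tperm n \<sigma> S)
      = pm_extend (\<lambda>xs. pure_poly (permute_list (inv \<sigma>) xs)) (mpoly.trep S)"
    by (simp add: mpoly.tperm_def pm_extend_pm_extend)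
  also have "\<dots> = pm_extend (\<lambda>xs. rename (apfst \<sigma>) (pure_poly xs)) (mpoly.trep S)"
    using assms by (intro pm_extend_cong pure_poly_permute) (simp add: length_of_trep_key)
  finally show ?thesis by (simp add: tens_poly_def rename_pm_extend)
qed

text \<open>
  Only positions below \<open>n\<close> occur in the image of the \<open>n\<close>-th tensor power.
\<close>

lemma rename_tens_poly_cong:
  assumes "S \<in> mpoly.tpow n" and "\<And>i. i < n \<Longrightarrow> g i = h i"
  shows "rename (apfst g) (tens_poly S) = rename (apfst h) (tens_poly S)"
  using assms
  by (auto simp: tens_poly_def rename_pm_extend length_of_trep_key pure_poly_def rename_prod
      rename_rename apfst_comp_Pair intro!: pm_extend_cong prod.cong)

text \<open>
  Expanding every entry of a pure tensor in monomials shows that the tensors of monomials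
  generate the tensor power.
\<close>

lemma tfree_subset_of_monomials:
  fixes V :: "(('v, 'r::comm_ring_1) mpoly list \<Rightarrow>\<^sub>0 'r) set"
  assumes V: "pm.subspace V" and null: "mpoly.tnull n \<subseteq> V"
    and monomials: "\<And>ms :: ('v \<Rightarrow>\<^sub>0 nat) list. length ms = n \<Longrightarrow>
      Poly_Mapping.single (map (\<lambda>m. Poly_Mapping.single m 1) ms) 1 \<in> V"
  shows "mpoly.tfree n \<subseteq> V"
proof -
  let ?mon = "\<lambda>m :: 'v \<Rightarrow>\<^sub>0 nat. Poly_Mapping.single m (1::'r)"
  let ?s = "\<lambda>xs :: ('v, 'r) mpoly list. Poly_Mapping.single xs (1::'r)"
  have single: "?s xs \<in> V" if "length xs = n" "k \<le> n" "\<forall>i<n. k \<le> i \<longrightarrow> xs ! i \<in> range ?mon" for xs k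
    using that
  proof (induction k arbitrary: xs)
    case 0
    then have "\<forall>x\<in>set xs. x \<in> range ?mon" by (auto simp: in_set_conv_nth)
    then have "\<exists>ms. xs = map ?mon ms"
      by (induction xs) (auto intro: exI[of _ "_ # _"])
    then show ?case using monomials 0 by auto
  next
    case (Suc k)
    have add: "?s (xs[k := a + b]) \<in> V" if "?s (xs[k := a]) \<in> V" "?s (xs[k := b]) \<in> V" for a b
    proof -
      have "?s (xs[k := a + b]) - ?s (xs[k := a]) - ?s (xs[k := b]) \<in> V"
        using mpoly.tnull_add[of xs n k a b] null Suc.prems by auto
      from pm.subspace_add[OF V pm.subspace_add[OF V this that(2)] that(1)] show ?thesis by simp
    qed
    have scale: "?s (xs[k := pm_scale r a]) \<in> V" if "?s (xs[k := a]) \<in> V" for r a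
    proof -
      have "?s (xs[k := pm_scale r a]) - pm_scale r (?s (xs[k := a])) \<in> V"
        using mpoly.tnull_scale[of xs n k r a] null Suc.prems by auto
      from pm.subspace_add[OF V this pm.subspace_scale[OF V that, of r]] show ?thesis by simp
    qed
    have "?s (xs[k := p]) \<in> V" for p
    proof (induction p rule: poly_mapping_single_induct)
      case (single m c)
      have "?s (xs[k := ?mon m]) \<in> V"
        using Suc.prems by (intro Suc.IH) (auto simp: nth_list_update)
      from scale[OF this, of c] show ?case by (simp add: mpoly.single_eq_pm_scale[symmetric])
    qed (rule add)
    from this[of "xs ! k"] show ?case by simp
  qed
  show ?thesis
  proof
    fix f :: "('v, 'r) mpoly list \<Rightarrow>\<^sub>0 'r" assume f: "f \<in> mpoly.tfree n"
    have "f = pm_extend ?s f"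
      by (subst poly_mapping_expand) (simp add: pm_extend_def mpoly.single_eq_pm_scale[symmetric])
    moreover have "pm_extend ?s f \<in> V"
      using f by (intro mpoly.pm_extend_in_subspace V single[of _ n]) (auto simp: mpoly.tfree_def)
    ultimately show "f \<in> V" by simp
  qed
qed

definition split_monomial :: "nat \<Rightarrow> (nat \<times> 'v \<Rightarrow>\<^sub>0 nat) \<Rightarrow> ('v, 'r::comm_ring_1) mpoly list" where
  "split_monomial n m = map (\<lambda>i. Poly_Mapping.single (Poly_Mapping.map_key (Pair i) m) 1) [0..<n]"

lemma lookup_push_Pair:
  "Poly_Mapping.lookup (push (Pair j) m) (i, x) = (if i = j then Poly_Mapping.lookup m x else 0)"
  by (induction m rule: poly_mapping_single_induct)
    (auto simp: push_add lookup_add lookup_single when_def)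

lemma pure_poly_monomials:
  "pure_poly (map (\<lambda>m. Poly_Mapping.single m 1) ms)
    = Poly_Mapping.single (\<Sum>i<length ms. push (Pair i) (ms ! i)) 1"
proof -
  have "(\<Prod>i\<in>I. Poly_Mapping.single (g i) 1) = Poly_Mapping.single (\<Sum>i\<in>I. g i) 1"
    for I :: "nat set" and g :: "nat \<Rightarrow> (nat \<times> 'a \<Rightarrow>\<^sub>0 nat)"
    by (induction I rule: infinite_finite_induct) (simp_all add: mult_single)
  then show ?thesis by (simp add: pure_poly_def)
qed

lemma split_pure_poly_monomials:
  assumes "length ms = n"
  shows "split_monomial n (\<Sum>i<n. push (Pair i) (ms ! i)) = map (\<lambda>m. Poly_Mapping.single m 1) ms"
proof (rule nth_equalityI)
  fix i assume "i < length (split_monomial n (\<Sum>i<n. push (Pair i) (ms ! i)) :: ('a, 'b) mpoly list)"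
  then have i: "i < n" by (simp add: split_monomial_def)
  then have "Poly_Mapping.map_key (Pair i) (\<Sum>i<n. push (Pair i) (ms ! i)) = ms ! i"
    by (intro poly_mapping_eqI)
      (simp add: Poly_Mapping.map_key.rep_eq inj_def lookup_sum lookup_push_Pair)
  then show "split_monomial n (\<Sum>i<n. push (Pair i) (ms ! i)) ! i
      = (map (\<lambda>m. Poly_Mapping.single m 1) ms ! i :: ('a, 'b) mpoly)"
    using i assms by (simp add: split_monomial_def)
qed (simp add: split_monomial_def assms)

text \<open>
  Splitting a monomial in the variables \<open>(i, v)\<close> into its parts for the single positions \<open>i\<close>
  inverts \<open>tens_poly\<close> up to \<open>tnull n\<close>; on tensors of monomials this is visible, and these
  generate the tensor power.
\<close>

lemma tens_poly_eq_0_imp: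
  fixes S :: "(('v, 'r::comm_ring_1) mpoly, 'r) tens"
  assumes S: "S \<in> mpoly.tpow n" and "tens_poly S = 0"
  shows "S = mpoly.tzero n"
proof -
  define from_poly :: "(nat \<times> 'v, 'r) mpoly \<Rightarrow> (('v, 'r) mpoly list \<Rightarrow>\<^sub>0 'r)" where
    "from_poly = pm_extend (\<lambda>m. Poly_Mapping.single (split_monomial n m) 1)"
  define V where "V = {f :: ('v, 'r) mpoly list \<Rightarrow>\<^sub>0 'r. from_poly (pm_extend pure_poly f) - f \<in> mpoly.tnull n}"
  have from_poly_0: "from_poly 0 = 0" by (simp add: from_poly_def pm_extend_def)
  have "pm.subspace V"
  proof (rule pm.subspaceI)
    show "0 \<in> V"
      using pm.subspace_0[OF mpoly.subspace_tnull] from_poly_0 by (simp add: V_def pm_extend_def)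
    show "f + g \<in> V" if "f \<in> V" "g \<in> V" for f g
      using pm.subspace_add[OF mpoly.subspace_tnull, of _ n] that
      by (fastforce simp: V_def from_poly_def pm_extend_add add_diff_add)
    show "pm_scale r f \<in> V" if "f \<in> V" for r f
      using pm.subspace_scale[OF mpoly.subspace_tnull, of _ n r] that
      by (fastforce simp: V_def from_poly_def pm_extend_scale pm.scale_right_diff_distrib)
  qed
  moreover have "mpoly.tnull n \<subseteq> V"
    using pm.subspace_neg[OF mpoly.subspace_tnull]
    by (auto simp: V_def pm_extend_pure_poly_tnull from_poly_0)
  moreover have "Poly_Mapping.single (map (\<lambda>m. Poly_Mapping.single m 1) ms) 1 \<in> V"
    if "length ms = n" for ms
    using that pm.subspace_0[OF mpoly.subspace_tnull]
    by (simp add: V_def from_poly_def pure_poly_monomials split_pure_poly_monomials)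
  ultimately have "mpoly.tfree n \<subseteq> V" by (rule tfree_subset_of_monomials)
  with S have "mpoly.trep S \<in> V" using mpoly.trep_in_tfree by blast
  then have "mpoly.trep S \<in> mpoly.tnull n"
    using assms(2) pm.subspace_neg[OF mpoly.subspace_tnull]
    by (fastforce simp: V_def tens_poly_def[symmetric] from_poly_0)
  then have "mpoly.tclass n (mpoly.trep S) = mpoly.tclass n 0"
    by (simp add: mpoly.tclass_eq_iff)
  then show ?thesis using mpoly.tclass_trep[OF S] by (simp add: mpoly.tzero_def)
qed

section \<open>Linear maps between tensor powers\<close>

context assoc_algebra
begin

lemma tzero_in_tpow [simp]: "tzero n \<in> tpow n"
  using pm.subspace_0[OF subspace_tfree] by (simp add: tzero_def tpow_def)

lemma tadd_in_tpow: "S \<in> tpow n \<Longrightarrow> T \<in> tpow n \<Longrightarrow> tadd n S T \<in> tpow n"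
  by (auto simp: tpow_def tadd_class pm.subspace_add[OF subspace_tfree])

lemma tscale_in_tpow: "S \<in> tpow n \<Longrightarrow> tscale n r S \<in> tpow n"
  by (auto simp: tpow_def tscale_class pm.subspace_scale[OF subspace_tfree])

lemma tadd_zero [simp]: "tadd n (tzero n) (tzero n) = tzero n"
  by (simp add: tzero_def tadd_class)

lemma tscale_zero [simp]: "tscale n r (tzero n) = tzero n"
  by (simp add: tzero_def tscale_class)

lemma tneg_zero [simp]: "tneg n (tzero n) = tzero n"
  by (simp add: tzero_def tneg_class)

lemma tsum_eq_zero: "(\<And>i. i \<in> I \<Longrightarrow> F i = tzero n) \<Longrightarrow> tsum n F I = tzero n"
  using tsum_class[of n "\<lambda>_. 0" I] by (simp add: tsum_def tzero_def)

lemma tmult_zero_left: "S \<in> tpow n \<Longrightarrow> tmult n (tzero n) S = tzero n"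
  by (auto simp: tzero_def tpow_def tmult_class pm.subspace_0[OF subspace_tfree] fmult_def pm_extend_def[of _ 0])

lemma tmult_zero_right: "S \<in> tpow n \<Longrightarrow> tmult n S (tzero n) = tzero n"
  by (auto simp: tzero_def tpow_def tmult_class pm.subspace_0[OF subspace_tfree] fmult_def pm_extend_def)

lemma tappend_zero_left: "S \<in> tpow n \<Longrightarrow> tappend m n (tzero m) S = tzero (m + n)"
  by (auto simp: tzero_def tpow_def tappend_class pm.subspace_0[OF subspace_tfree] fappend_def pm_extend_def[of _ 0])

lemma tperm_in_tpow:
  assumes "S \<in> tpow n"
  shows "tperm n \<sigma> S \<in> tpow n"
  using trep_in_tfree[OF assms] unfolding tperm_def tpow_def
  by (intro imageI pm_extend_in_subspace subspace_tfree) (simp add: tfree_def)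

lemma tperm_zero [simp]: "\<sigma> permutes {..<n} \<Longrightarrow> tperm n \<sigma> (tzero n) = tzero n"
  by (simp add: tzero_def tperm_class pm_extend_def)

lemma tmap_in_tpow:
  assumes "tlinear m m' \<phi>" "tlinear n n' \<psi>" "S \<in> tpow (m + n)"
  shows "tmap m m' n n' \<phi> \<psi> S \<in> tpow (m' + n')"
  unfolding tmap_def tpow_def[of "m' + n'"]
proof (intro imageI pm_extend_in_subspace subspace_tfree)
  fix xs assume "xs \<in> Poly_Mapping.keys (trep S)"
  then have "length xs = m + n" using trep_in_tfree[OF assms(3)] by (simp add: tfree_def)
  then have "\<phi> (tpure (take m xs)) \<in> tpow m'" "\<psi> (tpure (drop m xs)) \<in> tpow n'"
    using assms(1,2) by (simp_all add: tlinear_def)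
  then show "trep (tappend m' n' (\<phi> (tpure (take m xs))) (\<psi> (tpure (drop m xs)))) \<in> tfree (m' + n')"
    by (intro trep_in_tfree tappend_in_tpow)
qed

lemma tmap_eq_zero:
  assumes "\<And>xs. length xs = m + n \<Longrightarrow>
      tappend m' n' (\<phi> (tpure (take m xs))) (\<psi> (tpure (drop m xs))) = tzero (m' + n')"
    and "S \<in> tpow (m + n)"
  shows "tmap m m' n n' \<phi> \<psi> S = tzero (m' + n')"
proof -
  have "trep (tzero k) \<in> tnull k" for k
    using trep_tclass[of k 0] by (simp add: tzero_def)
  then have "pm_extend (\<lambda>xs. trep (tappend m' n' (\<phi> (tpure (take m xs))) (\<psi> (tpure (drop m xs)))))
      (trep S) \<in> tnull (m' + n')"
    using assms trep_in_tfree[OF assms(2)]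
    by (intro pm_extend_in_subspace subspace_tnull) (auto simp: tfree_def)
  then show ?thesis by (simp add: tmap_def tzero_def tclass_eq_iff)
qed

lemma tlinear_id: "tlinear n n id"
  by (simp add: tlinear_def)

text \<open>
  Pure tensors span the tensor power.
\<close>

lemma tlinear_eq_zero:
  assumes \<phi>: "tlinear n m \<phi>" and pure: "\<And>xs. length xs = n \<Longrightarrow> \<phi> (tpure xs) = tzero m"
    and S: "S \<in> tpow n"
  shows "\<phi> S = tzero m"
proof -
  obtain f where f: "f \<in> tfree n" "S = tclass n f" using S by (auto simp: tpow_def)
  have "(\<Sum>k\<in>K. Poly_Mapping.single k (c k)) \<in> tfree n \<and>
      \<phi> (tclass n (\<Sum>k\<in>K. Poly_Mapping.single k (c k))) = tzero m"
    if "finite K" "\<forall>k\<in>K. length k = n" for K and c :: "'a list \<Rightarrow> 'r"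
    using that
  proof (induction K)
    case empty
    have "tzero n = tscale n 0 (tzero n)" by simp
    then have "\<phi> (tzero n) = tscale m 0 (\<phi> (tzero n))"
      using \<phi> tzero_in_tpow[of n] unfolding tlinear_def by metis
    then show ?case
      using pm.subspace_0[OF subspace_tfree] by (simp add: tscale_def tzero_def)
  next
    case (insert k K)
    let ?R = "\<Sum>k\<in>K. Poly_Mapping.single k (c k)"
    have R: "tclass n ?R \<in> tpow n" and sk: "tscale n (c k) (tpure k) \<in> tpow n"
      using insert pm.subspace_scale[OF subspace_tfree]
      by (auto simp: tpow_def tpure_def tscale_class)
    have "tclass n (Poly_Mapping.single k (c k) + ?R) = tadd n (tscale n (c k) (tpure k)) (tclass n ?R)"
      using insert.prems
      by (simp add: tpure_def tscale_class tadd_class single_eq_pm_scale[of k "c k"])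
    then have "\<phi> (tclass n (Poly_Mapping.single k (c k) + ?R)) = tzero m"
      using \<phi> R sk insert pure by (simp add: tlinear_def)
    then show ?case
      using insert pm.subspace_add[OF subspace_tfree] by simp
  qed
  from this[of "Poly_Mapping.keys f" "Poly_Mapping.lookup f"] f show ?thesis
    by (simp add: tfree_def poly_mapping_expand[symmetric])
qed

end

lemma transpose_permutes: "transpose 0 1 permutes {..<2::nat}"
  by (rule permutes_swap_id) auto

lemma cyclic_perms_permute: "\<sigma> \<in> mpoly.cyclic_perms n \<Longrightarrow> \<sigma> permutes {..<n}"
  unfolding mpoly.cyclic_perms_def
  using permutes_funpow[OF cycle_permutes[of "[0..<n]"]] by (auto simp: atLeast0LessThan)

lemma cyclic_perms_3:
  fixes c :: "nat \<Rightarrow> nat"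
  defines "c \<equiv> transpose 0 1 \<circ> transpose 1 2"
  shows "mpoly.cyclic_perms 3 = {id, c, c \<circ> c}"
proof -
  have c: "cycle_of_list [0..<3] = c" by (simp add: c_def numeral_3_eq_3 numeral_2_eq_2)
  have "(c ^^ 3) x = x" for x
    by (simp add: c_def numeral_3_eq_3 transpose_def)
  then have mod: "c ^^ k = c ^^ (k mod 3)" for k
    using funpow_mod_eq[of 3 c] by (metis ext)
  have "range (\<lambda>k. c ^^ k) = (\<lambda>k. c ^^ k) ` {..<3}"
  proof (intro equalityI subsetI)
    fix f assume "f \<in> range (\<lambda>k. c ^^ k)"
    then obtain k where "f = c ^^ k" by auto
    then show "f \<in> (\<lambda>k. c ^^ k) ` {..<3}" using mod[of k] by (intro image_eqI[of _ _ "k mod 3"]) auto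
  qed auto
  moreover have "{..<3::nat} = {0, 1, 2}" by auto
  ultimately show ?thesis by (simp add: mpoly.cyclic_perms_def c numeral_2_eq_2)
qed

lemma sum_cyclic_perms_3:
  fixes c :: "nat \<Rightarrow> nat"
  defines "c \<equiv> transpose 0 1 \<circ> transpose 1 2"
  shows "(\<Sum>\<sigma>\<in>mpoly.cyclic_perms 3. f \<sigma>) = f id + f c + f (c \<circ> c)"
proof -
  have "id \<noteq> c" "id \<noteq> c \<circ> c" "c \<noteq> c \<circ> c"
    by (auto simp: fun_eq_iff c_def transpose_def intro!: exI[of _ 0])
  then show ?thesis unfolding cyclic_perms_3 c_def[symmetric] by (simp add: add.assoc)
qed

section \<open>Double brackets on a polynomial algebra\<close>

abbreviation slot_diff :: "('v, 'r::comm_ring_1) mpoly \<Rightarrow> (nat \<times> 'v, 'r) mpoly" where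
  "slot_diff a \<equiv> slot 0 a - slot 1 a"

abbreviation place :: "nat \<Rightarrow> nat \<Rightarrow> (nat \<times> 'v, 'r::comm_ring_1) mpoly \<Rightarrow> (nat \<times> 'v, 'r) mpoly" where
  "place i j \<equiv> rename (apfst (\<lambda>k. if k = 0 then i else j))"

text \<open>
  Write \<open>u\<close> and \<open>u'\<close> for the differences belonging to two distinct variables.
  The hypothesis \<open>comm\<close> makes \<open>u\<close> divide \<open>u' * B c (var v)\<close>, hence \<open>B c (var v)\<close>, and the
  quotient \<open>h c\<close> then works for every second argument.  By skew symmetry the same happens in the
  first argument: comparing the two descriptions of \<open>B (var v) (var w)\<close> shows that \<open>u\<close> divides
  \<open>h (var v)\<close>, and the quotient \<open>g\<close> works for every first argument.
\<close>

lemma eq_slot_diff_mult_slot_diff_mult: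
  fixes B :: "('v, 'r::comm_ring_1) mpoly \<Rightarrow> ('v, 'r) mpoly \<Rightarrow> (nat \<times> 'v, 'r) mpoly" and v w :: 'v
  assumes vw: "v \<noteq> w"
    and comm: "\<And>a b c. slot_diff a * B c b = slot_diff b * B c a"
    and skew: "\<And>a b. B a b = - rename (apfst (transpose 0 1)) (B b a)"
  obtains G where "\<And>a b. B a b = slot_diff a * slot_diff b * G"
proof -
  let ?s = "rename (apfst (transpose 0 1)) :: (nat \<times> 'v, 'r) mpoly \<Rightarrow> _"
  let ?u = "slot_diff (var v) :: (nat \<times> 'v, 'r) mpoly" and ?u' = "slot_diff (var w) :: (nat \<times> 'v, 'r) mpoly"
  have dvd: "?u dvd f" if "?u * g = ?u' * f" for f g
    using that vw var_diff_dvd_of_dvd_mult[of "(0, w)" "(1, w)" "(0, v)" "(1, v)" f] by (simp add: dvd_def)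
      metis
  have cancel: "f = g" if "?u * f = ?u * g" for f g
    using that var_diff_mult_cancel[of "(0, v)" "(1, v)" f g] by simp
  have "\<exists>h. B c (var v) = ?u * h" for c
    using dvd[OF comm[of "var v" c "var w"]] by (elim dvdE) blast
  then obtain h where h: "\<And>c. B c (var v) = ?u * h c" by metis
  have right: "B c b = slot_diff b * h c" for b c
    by (rule cancel) (simp only: comm[of "var v" c b] h mult.left_commute)
  have left: "B a b = slot_diff a * ?s (h b)" for a b
    by (subst skew) (simp add: right rename_mult rename_diff rename_rename apfst_comp_Pair algebra_simps)
  have "?u * ?s (h (var w)) = ?u' * h (var v)"
    using left[of "var v" "var w"] right[of "var v" "var w"] by simp
  from dvd[OF this] obtain g where g: "h (var v) = ?u * g" by (elim dvdE)
  have "?s (h b) = slot_diff b * g" for b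
    by (rule cancel) (simp only: left[symmetric] right g mult.left_commute)
  then show thesis using that[of g] left by (simp add: mult.assoc)
qed

lemma pure_poly_pair: "pure_poly [a, b] = slot 0 a * slot 1 b"
  by (simp add: pure_poly_def lessThan_Suc numeral_2_eq_2 mult.commute)

lemma double_bracket_in_tpow:
  "mpoly.double_bracket \<phi> \<Longrightarrow> \<phi> (mpoly.tpure [a, b]) \<in> mpoly.tpow 2"
  by (simp add: mpoly.double_bracket_def mpoly.tlinear_def)

text \<open>
  Since \<open>a * b = b * a\<close>, the derivation rule expands \<open>\<phi>(c \<otimes> ab)\<close> in two ways; the
  equation results from collecting the terms with the same value of \<open>\<phi>\<close> on either side.
\<close>

lemma double_bracket_comm:
  assumes \<phi>: "mpoly.double_bracket \<phi>"
  shows "slot_diff a * tens_poly (\<phi> (mpoly.tpure [c, b])) = slot_diff b * tens_poly (\<phi> (mpoly.tpure [c, a]))"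
proof -
  have leibniz: "tens_poly (\<phi> (mpoly.tpure [c, a * b]))
      = slot 0 a * tens_poly (\<phi> (mpoly.tpure [c, b])) + tens_poly (\<phi> (mpoly.tpure [c, a])) * slot 1 b" for a b
    using \<phi> by (simp add: mpoly.double_bracket_def mpoly.derivation_last_def tens_poly_add tens_poly_mult
        double_bracket_in_tpow[OF \<phi>] pure_poly_pair)
  show ?thesis
    using leibniz[of a b] leibniz[of b a] unfolding mult.commute[of b a] by (simp add: algebra_simps)
qed

lemma double_bracket_skew:
  assumes \<phi>: "mpoly.double_bracket \<phi>"
  shows "tens_poly (\<phi> (mpoly.tpure [a, b]))
    = - rename (apfst (transpose 0 1)) (tens_poly (\<phi> (mpoly.tpure [b, a])))"
proof -
  let ?\<tau> = "mpoly.tperm 2 (transpose 0 1)"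
  have "permute_list (inv (transpose 0 1)) [a, b] = [b, a]"
    by (simp add: permute_list_def)
  then have "?\<tau> (mpoly.tpure [a, b]) = mpoly.tpure [b, a]"
    using mpoly.tperm_pure[OF transpose_permutes, of "[a, b]"] by simp
  moreover have "(?\<tau> \<circ> \<phi> \<circ> ?\<tau>) (mpoly.tpure [a, b]) = mpoly.tneg 2 (\<phi> (mpoly.tpure [a, b]))"
    using \<phi> by (simp add: mpoly.double_bracket_def Let_def)
  ultimately have "tens_poly (?\<tau> (\<phi> (mpoly.tpure [b, a]))) = - tens_poly (\<phi> (mpoly.tpure [a, b]))"
    by (simp add: tens_poly_neg)
  then show ?thesis
    by (simp only: tens_poly_perm[OF transpose_permutes double_bracket_in_tpow[OF \<phi>]] minus_minus)
qed

lemma rename_id: "rename id f = f"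
  by (induction f rule: mpoly_induct) (simp_all add: rename_add rename_mult)

lemma place_0_1_tens_poly: "S \<in> mpoly.tpow 2 \<Longrightarrow> place 0 1 (tens_poly S) = tens_poly S"
  using rename_tens_poly_cong[of S 2 "\<lambda>k. if k = 0 then 0 else 1" id]
  by (simp add: apfst_def map_prod.id rename_id)

lemma apfst_comp_apfst: "apfst g \<circ> apfst h = apfst (g \<circ> h)"
  by (simp add: fun_eq_iff)

lemma rename_apfst_rename_apfst: "rename (apfst g) (rename (apfst h) f) = rename (apfst (g \<circ> h)) f"
  by (simp only: rename_rename apfst_comp_apfst)

lemma rename_place: "rename (apfst h) (place i j f) = place (h i) (h j) f"
  by (simp add: rename_apfst_rename_apfst comp_def if_distrib)

lemma place_swap_tens_poly:
  "S \<in> mpoly.tpow 2 \<Longrightarrow>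
    place i j (rename (apfst (transpose 0 1)) (tens_poly S)) = place j i (tens_poly S)"
  unfolding rename_apfst_rename_apfst
  by (rule rename_tens_poly_cong) (auto simp: transpose_def less_2_cases_iff)

lemma place_slot_diff: "place i j (slot_diff a) = slot i a - slot j a"
  by (simp add: rename_diff rename_rename apfst_comp_Pair)

text \<open>
  The map whose cyclic sum is the double Jacobiator.
\<close>

definition jac_term where
  "jac_term \<phi> = mpoly.tmap 2 2 1 1 \<phi> id \<circ> mpoly.tmap 1 1 2 2 id \<phi>"

lemma jac_term_in_tpow:
  assumes "mpoly.double_bracket \<phi>" and "S \<in> mpoly.tpow 3"
  shows "jac_term \<phi> S \<in> mpoly.tpow 3"
proof -
  have lin: "mpoly.tlinear 2 2 \<phi>" using assms(1) by (simp add: mpoly.double_bracket_def)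
  have "mpoly.tmap 1 1 2 2 id \<phi> S \<in> mpoly.tpow (1 + 2)"
    by (rule mpoly.tmap_in_tpow[OF mpoly.tlinear_id lin]) (use assms(2) in \<open>simp del: One_nat_def\<close>)
  then have "jac_term \<phi> S \<in> mpoly.tpow (2 + 1)"
    unfolding jac_term_def o_apply
    by (intro mpoly.tmap_in_tpow[OF lin mpoly.tlinear_id]) (simp add: add.commute)
  then show ?thesis by simp
qed

text \<open>
  Let \<open>p \<otimes> q\<close> be a summand of \<open>\<phi>(b \<otimes> c)\<close>.  The outer application of \<open>\<phi>\<close> turns it into
  the product of \<open>slot_diff a * G\<close> with \<open>slot_diff p * slot 2 q\<close>, and in the last factor \<open>\<phi>(b \<otimes> c)\<close>
  can be recognised again: once at the positions 0, 2 and once at the positions 1, 2.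
\<close>

lemma tens_poly_jac_term:
  assumes \<phi>: "mpoly.double_bracket \<phi>"
    and G: "\<And>a b. tens_poly (\<phi> (mpoly.tpure [a, b])) = slot_diff a * slot_diff b * G"
  shows "tens_poly (jac_term \<phi> (mpoly.tpure [a, b, c])) = slot_diff a * G *
    (place 0 2 (tens_poly (\<phi> (mpoly.tpure [b, c]))) - place 1 2 (tens_poly (\<phi> (mpoly.tpure [b, c]))))"
proof -
  have lin: "mpoly.tlinear 2 2 \<phi>" using \<phi> by (simp add: mpoly.double_bracket_def)
  define T where "T = \<phi> (mpoly.tpure [b, c])"
  have T: "T \<in> mpoly.tpow 2" unfolding T_def by (rule double_bracket_in_tpow[OF \<phi>])
  note f = mpoly.trep_in_tfree[OF T]
  have "mpoly.tmap 1 1 2 2 id \<phi> (mpoly.tpure [a, b, c]) = mpoly.tappend 1 2 (mpoly.tpure [a]) T"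
    using mpoly.tmap_pure[OF mpoly.tlinear_id lin, of "[a]" 1 "[b, c]"] by (simp add: T_def)
  also have "\<dots> = mpoly.tappend 1 2 (mpoly.tclass 1 (Poly_Mapping.single [a] 1)) (mpoly.tclass 2 (mpoly.trep T))"
    by (simp add: mpoly.tpure_def mpoly.tclass_trep[OF T])
  also have "\<dots> = mpoly.tclass (2 + 1) (pm_extend (\<lambda>ys. Poly_Mapping.single (a # ys) 1) (mpoly.trep T))"
    using mpoly.tappend_class[OF mpoly.tfree_single f, of "[a]" 1 1]
    by (simp add: mpoly.fappend_def del: One_nat_def)
  finally have "tens_poly (jac_term \<phi> (mpoly.tpure [a, b, c])) = pm_extend (\<lambda>ys. tens_poly
      (mpoly.tappend 2 1 (\<phi> (mpoly.tpure (take 2 (a # ys)))) (mpoly.tpure (drop 2 (a # ys))))) (mpoly.trep T)"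
    unfolding jac_term_def o_apply
    by (simp only: mpoly.tmap_class[OF lin mpoly.tlinear_id] tens_poly_class pm_extend_pm_extend)
      (simp add: tens_poly_def)
  also have "\<dots> = pm_extend (\<lambda>ys. slot_diff a * G * (place 0 2 (pure_poly ys) - place 1 2 (pure_poly ys))) (mpoly.trep T)"
  proof (rule pm_extend_cong)
    fix ys assume "ys \<in> Poly_Mapping.keys (mpoly.trep T)"
    then have "length ys = 2" by (rule length_of_trep_key[OF T])
    then obtain p q where ys: "ys = [p, q]" by (auto simp: length_Suc_conv numeral_2_eq_2)
    have "tens_poly (mpoly.tappend 2 1 (\<phi> (mpoly.tpure [a, p])) (mpoly.tpure [q])) = slot_diff a * slot_diff p * G * slot 2 q"
      by (simp add: tens_poly_append[OF double_bracket_in_tpow[OF \<phi>]] G pure_poly_def rename_rename apfst_comp_Pair)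
    then show "tens_poly (mpoly.tappend 2 1 (\<phi> (mpoly.tpure (take 2 (a # ys)))) (mpoly.tpure (drop 2 (a # ys))))
        = slot_diff a * G * (place 0 2 (pure_poly ys) - place 1 2 (pure_poly ys))"
      by (simp add: ys pure_poly_pair rename_mult rename_rename apfst_comp_Pair algebra_simps)
  qed
  also have "\<dots> = slot_diff a * G * (place 0 2 (tens_poly T) - place 1 2 (tens_poly T))"
    by (simp add: pm_extend_mult_left pm_extend_minus tens_poly_def rename_pm_extend)
  finally show ?thesis by (simp add: T_def)
qed

text \<open>
  On \<open>x \<otimes> x \<otimes> x\<close> the inner permutation of the arguments does nothing, so the three summands
  are renamings of one polynomial.
\<close>

lemma tens_poly_double_jacobiator_diagonal:
  assumes \<phi>: "mpoly.double_bracket \<phi>"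
  shows "tens_poly (mpoly.double_jacobiator \<phi> (mpoly.tpure [x, x, x]))
    = (\<Sum>\<sigma>\<in>mpoly.cyclic_perms 3. rename (apfst \<sigma>) (tens_poly (jac_term \<phi> (mpoly.tpure [x, x, x]))))"
  unfolding mpoly.double_jacobiator_def tens_poly_sum
proof (rule sum.cong[OF refl])
  fix \<sigma> :: "nat \<Rightarrow> nat" assume "\<sigma> \<in> mpoly.cyclic_perms 3"
  then have \<sigma>: "\<sigma> permutes {..<3}" by (rule cyclic_perms_permute)
  have "permute_list \<sigma> [x, x, x] = [x, x, x]"
  proof (rule nth_equalityI)
    fix i assume "i < length (permute_list \<sigma> [x, x, x])"
    then have "\<sigma> i < 3" "i < 3" using permutes_in_image[OF \<sigma>, of i] by simp_all
    moreover have "[x, x, x] ! k = x" if "k < 3" for k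
      using that by (auto simp: less_Suc_eq numeral_3_eq_3)
    ultimately show "permute_list \<sigma> [x, x, x] ! i = [x, x, x] ! i"
      using \<sigma> by (simp add: permute_list_nth numeral_3_eq_3)
  qed simp
  then have "mpoly.tperm 3 (inv \<sigma>) (mpoly.tpure [x, x, x]) = mpoly.tpure [x, x, x]"
    using mpoly.tperm_pure[OF permutes_inv[OF \<sigma>], of "[x, x, x]"] by (simp add: permutes_inv_inv[OF \<sigma>])
  moreover have "jac_term \<phi> (mpoly.tpure [x, x, x]) \<in> mpoly.tpow 3"
    by (rule jac_term_in_tpow[OF \<phi>]) simp
  ultimately show "tens_poly (mpoly.sym_act 3 \<sigma> (mpoly.tmap 2 2 1 1 \<phi> id \<circ> mpoly.tmap 1 1 2 2 id \<phi>)
      (mpoly.tpure [x, x, x])) = rename (apfst \<sigma>) (tens_poly (jac_term \<phi> (mpoly.tpure [x, x, x])))"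
    unfolding jac_term_def[symmetric] mpoly.sym_act_def by (simp add: tens_poly_perm[OF \<sigma>])
qed

text \<open>
  The cyclic sum in the Jacobiator of a bracket \<open>slot_diff a * slot_diff b * g\<close> at a variable
  whose copies at the positions 0, 1, 2 are \<open>x\<close>, \<open>y\<close>, \<open>z\<close>: the copies of \<open>g\<close> at the positions 01, 02, 12 are
  \<open>p\<close>, \<open>q\<close>, \<open>r\<close>, so by skew symmetry those at 10, 20, 21 are \<open>- p\<close>, \<open>- q\<close>, \<open>- r\<close>.
\<close>

lemma cyclic_sum_factorization:
  fixes x y z p q r :: "'a::comm_ring_1"
  shows "(x - y) * p * ((x - z) * (x - z) * q - (y - z) * (y - z) * r)
    + (y - z) * r * ((y - x) * (y - x) * - p - (z - x) * (z - x) * - q)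
    + (z - x) * - q * ((z - y) * (z - y) * - r - (x - y) * (x - y) * p)
    = (x - y) * ((y - z) * ((x - z) * (p * q - p * r + q * r)))"
  by (simp add: algebra_simps)

text \<open>
  In the product form of the bracket, the Jacobi identity at \<open>var v \<otimes> var v \<otimes> var v\<close> becomes
  \<open>g 0 1 * g 0 2 - g 0 1 * g 1 2 + g 0 2 * g 1 2 = 0\<close> after cancelling three differences of
  variables.  Restricting to the diagonal where the last two positions agree leaves
  \<open>g 0 1 * g 0 1 = 0\<close>.
\<close>

lemma double_poisson_imp_zero:
  fixes \<phi> :: "(('v, 'r::comm_ring_1) mpoly, 'r) tens \<Rightarrow> (('v, 'r) mpoly, 'r) tens"
  assumes reduced: "\<And>x::'r. x ^ 2 = 0 \<Longrightarrow> x = 0" and vw: "(v :: 'v) \<noteq> w"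
    and \<phi>: "mpoly.double_poisson \<phi>" and S: "S \<in> mpoly.tpow 2"
  shows "\<phi> S = mpoly.tzero 2"
proof -
  note One_nat_def [simp del]
  define B where "B a b = tens_poly (\<phi> (mpoly.tpure [a, b]))" for a b
  have br: "mpoly.double_bracket \<phi>" using \<phi> by (simp add: mpoly.double_poisson_def)
  obtain G0 where G0: "\<And>a b. B a b = slot_diff a * slot_diff b * G0"
    using eq_slot_diff_mult_slot_diff_mult[OF vw, of B] double_bracket_comm[OF br] double_bracket_skew[OF br]
    unfolding B_def by blast
  \<comment> \<open>\<open>G0\<close> might contain further positions; \<open>g 0 1\<close> is a cofactor without them.\<close>
  define g where "g i j = place i j G0" for i j
  have place_B: "place i j (B a b) = (slot i a - slot j a) * (slot i b - slot j b) * g i j" for i j a b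
    by (simp only: G0 rename_mult place_slot_diff g_def)
  have B: "B a b = slot_diff a * slot_diff b * g 0 1" for a b
    using place_B[of 0 1 a b] place_0_1_tens_poly[OF double_bracket_in_tpow[OF br], of a b] by (simp add: B_def)
  define x where "x = (\<lambda>i. var (i, v) :: (nat \<times> 'v, 'r) mpoly)"
  have slot_x: "slot i (var v) = x i" for i by (simp add: x_def)
  have cancel: "f = 0" if "(x i - x j) * f = 0" "i \<noteq> j" for i j f
    using that var_diff_mult_eq_0[of "(i, v)" "(j, v)" f] by (simp add: x_def)
  \<comment> \<open>Both differences change sign under the swap, so skew symmetry passes to the cofactor.\<close>
  have skew: "g j i = - g i j" if "i \<noteq> j" for i j
  proof -
    have "place i j (B (var v) (var v)) = - place j i (B (var v) (var v))"
      unfolding B_def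
      by (subst double_bracket_skew[OF br])
        (simp only: rename_uminus place_swap_tens_poly[OF double_bracket_in_tpow[OF br]])
    then have "(x i - x j) * (x i - x j) * g i j = - ((x j - x i) * (x j - x i) * g j i)"
      by (simp only: place_B slot_x)
    then have "(x i - x j) * ((x i - x j) * (g i j + g j i)) = 0"
      by (simp add: algebra_simps)
    then have "g i j + g j i = 0" using cancel[OF _ that] by blast
    then show ?thesis by (simp add: eq_neg_iff_add_eq_0 add.commute)
  qed
  let ?t = "mpoly.tpure [var v, var v, var v] :: (('v, 'r) mpoly, 'r) tens"
  have J: "tens_poly (jac_term \<phi> ?t) = (x 0 - x 1) * g 0 1 *
      ((x 0 - x 2) * (x 0 - x 2) * g 0 2 - (x 1 - x 2) * (x 1 - x 2) * g 1 2)"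
    using tens_poly_jac_term[OF br B[unfolded B_def]] by (simp add: B_def[symmetric] place_B x_def)
  have ren [simp]: "rename (apfst h) (x i) = x (h i)" "rename (apfst h) (g i j) = g (h i) (h j)" for h i j
    by (simp_all add: x_def g_def rename_place)
  have signs: "g 1 0 = - g 0 1" "g 2 0 = - g 0 2" "g 2 1 = - g 1 2"
    by (rule skew; simp)+
  have "(x 0 - x 1) * ((x 1 - x 2) * ((x 0 - x 2) * (g 0 1 * g 0 2 - g 0 1 * g 1 2 + g 0 2 * g 1 2))) =
      (x 0 - x 1) * g 0 1 * ((x 0 - x 2) * (x 0 - x 2) * g 0 2 - (x 1 - x 2) * (x 1 - x 2) * g 1 2) +
      (x 1 - x 2) * g 1 2 * ((x 1 - x 0) * (x 1 - x 0) * g 1 0 - (x 2 - x 0) * (x 2 - x 0) * g 2 0) +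
      (x 2 - x 0) * g 2 0 * ((x 2 - x 1) * (x 2 - x 1) * g 2 1 - (x 0 - x 1) * (x 0 - x 1) * g 0 1)"
    by (simp only: signs cyclic_sum_factorization)
  also have "\<dots> = tens_poly (mpoly.double_jacobiator \<phi> ?t)"
    unfolding tens_poly_double_jacobiator_diagonal[OF br] sum_cyclic_perms_3 J
    by (simp only: rename_mult rename_diff ren) (simp add: transpose_def)
  also have "\<dots> = 0"
    using \<phi> by (simp add: mpoly.double_poisson_def)
  finally have "(x 0 - x 1) * ((x 1 - x 2) * ((x 0 - x 2) *
      (g 0 1 * g 0 2 - g 0 1 * g 1 2 + g 0 2 * g 1 2))) = 0" .
  then have "(x 1 - x 2) * ((x 0 - x 2) * (g 0 1 * g 0 2 - g 0 1 * g 1 2 + g 0 2 * g 1 2)) = 0"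
    by (rule cancel) simp
  then have "(x 0 - x 2) * (g 0 1 * g 0 2 - g 0 1 * g 1 2 + g 0 2 * g 1 2) = 0"
    by (rule cancel) simp
  then have "g 0 1 * g 0 2 - g 0 1 * g 1 2 + g 0 2 * g 1 2 = 0"
    by (rule cancel) simp
  \<comment> \<open>Setting position 2 equal to 1, the last two terms cancel.\<close>
  then have "rename (apfst (id(2 := 1))) (g 0 1 * g 0 2 - g 0 1 * g 1 2 + g 0 2 * g 1 2) = 0"
    by simp
  then have "g 0 1 * g 0 1 = 0"
    by (simp add: rename_add rename_diff rename_mult)
  then have "g 0 1 = 0" by (rule mpoly_reduced[rotated]) (rule reduced)
  then have "\<phi> (mpoly.tpure [a, b]) = mpoly.tzero 2" for a b
    using B[of a b] tens_poly_eq_0_imp[OF double_bracket_in_tpow[OF br]] by (simp add: B_def)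
  then have pure: "\<phi> (mpoly.tpure xs) = mpoly.tzero 2" if "length xs = 2" for xs
    using that by (auto simp: length_Suc_conv numeral_2_eq_2)
  have "mpoly.tlinear 2 2 \<phi>" using br by (simp add: mpoly.double_bracket_def)
  then show ?thesis using pure S by (rule mpoly.tlinear_eq_zero)
qed

lemma zero_imp_double_poisson:
  fixes \<phi> :: "(('v, 'r::comm_ring_1) mpoly, 'r) tens \<Rightarrow> (('v, 'r) mpoly, 'r) tens"
  assumes \<phi>: "\<And>S. S \<in> mpoly.tpow 2 \<Longrightarrow> \<phi> S = mpoly.tzero 2"
  shows "mpoly.double_poisson \<phi>"
proof -
  have lin: "mpoly.tlinear 2 2 \<phi>"
    by (simp add: mpoly.tlinear_def \<phi> mpoly.tadd_in_tpow mpoly.tscale_in_tpow)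
  have br: "mpoly.double_bracket \<phi>"
    using lin by (simp add: mpoly.double_bracket_def mpoly.derivation_last_def \<phi> mpoly.tperm_in_tpow
        mpoly.tperm_zero[OF transpose_permutes] mpoly.tmult_zero_left mpoly.tmult_zero_right del: One_nat_def)
  have jac: "jac_term \<phi> S = mpoly.tzero 3" if "S \<in> mpoly.tpow 3" for S
  proof -
    have "mpoly.tmap 1 1 2 2 id \<phi> S \<in> mpoly.tpow (2 + 1)"
      using mpoly.tmap_in_tpow[OF mpoly.tlinear_id lin, of S 1] that by (simp del: One_nat_def)
    then have "mpoly.tmap 2 2 1 1 \<phi> id (mpoly.tmap 1 1 2 2 id \<phi> S) = mpoly.tzero (2 + 1)"
      by (intro mpoly.tmap_eq_zero) (simp_all add: \<phi> mpoly.tappend_zero_left)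
    then show ?thesis by (simp add: jac_term_def)
  qed
  have "mpoly.double_jacobiator \<phi> S = mpoly.tzero 3" if S: "S \<in> mpoly.tpow 3" for S
  proof -
    have "mpoly.sym_act 3 \<sigma> (jac_term \<phi>) S = mpoly.tzero 3" if "\<sigma> \<in> mpoly.cyclic_perms 3" for \<sigma>
      using cyclic_perms_permute[OF that] S by (simp add: mpoly.sym_act_def jac mpoly.tperm_in_tpow)
    then show ?thesis
      unfolding mpoly.double_jacobiator_def jac_term_def[symmetric]
      by (rule mpoly.tsum_eq_zero)
  qed
  with br show ?thesis by (simp add: mpoly.double_poisson_def)
qed

theorem theorem1:
  fixes \<phi> :: "(('v::finite, 'r::comm_ring_1) mpoly, 'r) tens \<Rightarrow> (('v, 'r) mpoly, 'r) tens"
  assumes reduced: "\<And>x::'r. x ^ 2 = 0 \<Longrightarrow> x = 0"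
    and variables: "CARD('v) \<ge> 2"
  shows "mpoly.double_poisson \<phi> \<longleftrightarrow> (\<forall>S \<in> mpoly.tpow 2. \<phi> S = mpoly.tzero 2)"
proof -
  have "\<not> CARD('v) \<le> Suc 0" using variables by simp
  then obtain v w :: 'v where "v \<noteq> w" by (auto simp: card_le_Suc0_iff_eq)
  show ?thesis
  proof
    assume "mpoly.double_poisson \<phi>"
    then show "\<forall>S \<in> mpoly.tpow 2. \<phi> S = mpoly.tzero 2"
      using double_poisson_imp_zero[OF reduced \<open>v \<noteq> w\<close>] by auto
  next
    assume "\<forall>S \<in> mpoly.tpow 2. \<phi> S = mpoly.tzero 2"
    then show "mpoly.double_poisson \<phi>" by (intro zero_imp_double_poisson) simp
  qed
qed

end
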